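(* Let $\mathfrak g$ be a finite-dimensional Lie bialgebra and suppose there is a linear map $\Xi:\mathfrak g^*\otimes\mathfrak g^*\to\mathfrak g^*$ such that $\Xi(\phi,\psi)-\Xi(\psi,\phi)=[\phi,\psi]_{\mathfrak g^*}$ for all $\phi,\psi\in\mathfrak g^*$. Let $\alpha:\mathfrak g^*\to\mathfrak g\otimes\mathfrak g^*$ be the linear map determined by $$\langle\alpha(\phi),\psi\otimes x\rangle=-\Xi(\psi,\phi)(x),\quad\forall\phi,\psi\in\mathfrak g^*,\ x\in\mathfrak g.$$ Then $\underline{\mathfrak g^*}=(\mathfrak g^*,[\ ,\ ]=0,\delta_{\mathfrak g^*},\mathrm{ad}^*,\alpha)$ is a braided-Lie bialgebra in the category ${}^{\mathfrak g}_{\mathfrak g}\mathcal M$ of left $\mathfrak g$-crossed modules if and only if $\Xi$ is a pre-Lie structure on $\mathfrak g^*$ which is covariant under $\delta_{\mathfrak g^*}$ in the sense $$\Xi(\phi,\psi)_{(1)}\otimes\Xi(\phi,\psi)_{(2)}=\Xi(\phi,\psi_{(1)})\otimes\psi_{(2)}+\psi_{(1)}\otimes\Xi(\phi,\psi_{(2)})$$ and satisfies $$\Xi(\phi_{(1)},\psi)\otimes\phi_{(2)}=\psi_{(1)}\otimes\Xi(\psi_{(2)},\phi)$$ for all $\phi,\psi\in\mathfrak g^*$. In this case, $\underline{\mathfrak g^*}\oplus\mathfrak g$ is a Lie bialgebra (the bisum of $\underline{\mathfrak g^*}$ and $\mathfrak g$) with Lie bracket $$[(\phi,x),(\psi,y)]=(\mathrm{ad}^*_x\psi-\mathrm{ad}^*_y\phi,[x,y]_{\mathfrak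 g})$$ and Lie cobracket $$\delta(\phi,X)=\delta_{\mathfrak g}X+\delta_{\mathfrak g^*}\phi+(\mathrm{id}-\tau)\alpha(\phi)$$ for $\phi,\psi\in\mathfrak g^*$, $x,y,X\in\mathfrak g$, where $\tau$ is the flip.
   Context: For a finite-dimensional Lie bialgebra $(\mathfrak g,[\ ,\ ]_{\mathfrak g},\delta_{\mathfrak g})$, the dual has $\langle[\phi,\psi]_{\mathfrak g^*},x\rangle=\langle\phi\otimes\psi,\delta_{\mathfrak g}x\rangle$, $\langle\delta_{\mathfrak g^*}\phi,x\otimes y\rangle=\langle\phi,[x,y]_{\mathfrak g}\rangle$; write $\delta_{\mathfrak g^*}\phi=\phi_{(1)}\otimes\phi_{(2)}$ and $\delta_{\mathfrak g}x=x_{(1)}\otimes x_{(2)}$. $\mathrm{ad}^*_x\phi=\phi_{(1)}\langle\phi_{(2)},x\rangle$, i.e. $(\mathrm{ad}^*_x\phi)(y)=-\phi([x,y])$. A left $\mathfrak g$-crossed module $(V,\triangleright,\alpha)$ is a left $\mathfrak g$-module with a left (Lie) coaction $\alpha:V\to\mathfrak g\otimes V$, $\alpha(v)=v^{(1)}\otimes v^{(2)}$, such that $\alpha(x\triangleright v)=([x,\ ]\otimes\mathrm{id}+\mathrm{id}\otimes x\triangleright)\alpha(v)+\delta_{\mathfrak g}(x)\triangleright v$, where $\delta_{\mathfrak g}(x)\triangleright v=x_{(1)}\otimes x_{(2)}\triangleright v$. Here $\alpha$ being a coaction means that $\phi\triangleright'v=\langle\phi,v^{(1)}\rangle v^{(2)}$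 is a left action of $\mathfrak g^{*op}$ ($\mathfrak g^*$ with bracket $-[\ ,\ ]_{\mathfrak g^*}$). A braided-Lie bialgebra $\mathfrak b\in{}^{\mathfrak g}_{\mathfrak g}\mathcal M$ is a left $\mathfrak g$-crossed module $(\mathfrak b,\triangleright,\alpha)$ that is both a Lie algebra and a Lie coalgebra $(\mathfrak b,\delta_{\mathfrak b})$, with Lie bracket and Lie cobracket morphisms of $\mathfrak g$-modules and $\mathfrak g$-comodules ($\mathfrak g$ acting and coacting on tensor products as derivations), and such that $$\Psi(x,y)=\mathrm{ad}_x\delta_{\mathfrak b}y-\mathrm{ad}_y\delta_{\mathfrak b}x-\delta_{\mathfrak b}([x,y]_{\mathfrak b})$$ for all $x,y\in\mathfrak b$, where the infinitesimal braiding is $\Psi(x,y)=y^{(1)}\triangleright x\otimes y^{(2)}-x^{(1)}\triangleright y\otimes x^{(2)}-y^{(2)}\otimes y^{(1)}\triangleright x+x^{(2)}\otimes x^{(1)}\triangleright y$. A pre-Lie structure on $\mathfrak g^*$ is a bilinear product $\Xi$ with $\Xi(\Xi(\phi,\psi),\zeta)-\Xi(\Xi(\psi,\phi),\zeta)=\Xi(\phi,\Xi(\psi,\zeta))-\Xi(\psi,\Xi(\phi,\zeta))$ and $\Xi(\phi,\psi)-\Xi(\psi,\phi)=[\phi,\psi]_{\mathfrak g^*}$. *)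

theory Defs
  imports "HOL-Analysis.Product_Vector" "HOL-Library.Function_Algebras"
begin

text \<open>
  Vector spaces over an arbitrary field \<open>'k\<close> are types with an explicit scalar multiplication, as in
  \<^locale>\<open>vector_space\<close>; \<open>Vector_Spaces.linear s (*) f\<close> says that \<open>f\<close> is a linear functional.
\<close>

section \<open>Algebraic tensor products\<close>

text \<open>
  \<open>V \<otimes> W\<close> is realised inside the functions of a pair of functionals: \<open>v \<otimes> w\<close> is
  \<open>(f, g) \<mapsto> f v * g w\<close>. Functionals separate points, so this is the tensor product, without any
  finiteness assumption (see \<open>sweedler_sum\<close> below for the universal property). Evaluating a tensor
  \<open>t\<close> at functionals \<open>f\<close>, \<open>g\<close> is the pairing \<open>\<langle>f \<otimes> g, t\<rangle>\<close>. Arguments that are not linear functionals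
  carry no information and are sent to 0.
\<close>

type_synonym ('k, 'v, 'w) tensor = "('v \<Rightarrow> 'k) \<Rightarrow> ('w \<Rightarrow> 'k) \<Rightarrow> 'k"

definition tens :: "('k::field \<Rightarrow> 'v::ab_group_add \<Rightarrow> 'v) \<Rightarrow> ('k \<Rightarrow> 'w::ab_group_add \<Rightarrow> 'w)
    \<Rightarrow> 'v \<Rightarrow> 'w \<Rightarrow> ('k, 'v, 'w) tensor" where
  "tens s1 s2 v w = (\<lambda>f g. if Vector_Spaces.linear s1 (*) f \<and> Vector_Spaces.linear s2 (*) g
                          then f v * g w else 0)"

definition tscale :: "'k::field \<Rightarrow> ('k, 'v, 'w) tensor \<Rightarrow> ('k, 'v, 'w) tensor" where
  "tscale c t = (\<lambda>f g. c * t f g)"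

definition tensor_space :: "('k::field \<Rightarrow> 'v::ab_group_add \<Rightarrow> 'v) \<Rightarrow> ('k \<Rightarrow> 'w::ab_group_add \<Rightarrow> 'w)
    \<Rightarrow> ('k, 'v, 'w) tensor set" where
  "tensor_space s1 s2 = range (\<lambda>ps. \<Sum>(v, w)\<leftarrow>ps. tens s1 s2 v w)"

text \<open>
  \<open>sweedler s1 s2 t b\<close> is the value at \<open>t\<close> of the linear map induced by the bilinear map \<open>b\<close>, that
  is, \<open>b t\<^sub>1 t\<^sub>2\<close> in Sweedler notation \<open>t = t\<^sub>1 \<otimes> t\<^sub>2\<close>.
\<close>

definition sweedler :: "('k::field \<Rightarrow> 'v::ab_group_add \<Rightarrow> 'v) \<Rightarrow> ('k \<Rightarrow> 'w::ab_group_add \<Rightarrow> 'w)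
    \<Rightarrow> ('k, 'v, 'w) tensor \<Rightarrow> ('v \<Rightarrow> 'w \<Rightarrow> 'u::ab_group_add) \<Rightarrow> 'u" where
  "sweedler s1 s2 t b =
     (\<Sum>(v, w)\<leftarrow>(SOME ps. t = (\<Sum>(v, w)\<leftarrow>ps. tens s1 s2 v w)). b v w)"

definition flip :: "('k, 'v, 'w) tensor \<Rightarrow> ('k, 'w, 'v) tensor" where
  "flip t = (\<lambda>f g. t g f)"

definition bilin :: "('k::field \<Rightarrow> 'v::ab_group_add \<Rightarrow> 'v) \<Rightarrow> ('k \<Rightarrow> 'w::ab_group_add \<Rightarrow> 'w)
    \<Rightarrow> ('k \<Rightarrow> 'u::ab_group_add \<Rightarrow> 'u) \<Rightarrow> ('v \<Rightarrow> 'w \<Rightarrow> 'u) \<Rightarrow> bool" where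
  "bilin s1 s2 s3 b \<longleftrightarrow> (\<forall>v. Vector_Spaces.linear s2 s3 (b v)) \<and>
                        (\<forall>w. Vector_Spaces.linear s1 s3 (\<lambda>v. b v w))"

definition linear_to_tensor :: "('k::field \<Rightarrow> 'u::ab_group_add \<Rightarrow> 'u)
    \<Rightarrow> ('k \<Rightarrow> 'v::ab_group_add \<Rightarrow> 'v) \<Rightarrow> ('k \<Rightarrow> 'w::ab_group_add \<Rightarrow> 'w)
    \<Rightarrow> ('u \<Rightarrow> ('k, 'v, 'w) tensor) \<Rightarrow> bool" where
  "linear_to_tensor s s1 s2 f \<longleftrightarrow> Vector_Spaces.linear s tscale f \<and> range f \<subseteq> tensor_space s1 s2"

lemma flip_tens: "flip (tens s1 s2 v w) = tens s2 s1 w v"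
  by (auto simp: flip_def tens_def fun_eq_iff)

lemma vector_space_tscale: "vector_space tscale"
  by unfold_locales (auto simp: tscale_def fun_eq_iff algebra_simps)

lemma bilin_tens:
  assumes "vector_space s1" "vector_space s2"
  shows "bilin s1 s2 tscale (tens s1 s2)"
proof -
  interpret v1: vector_space s1 by fact
  interpret v2: vector_space s2 by fact
  interpret vt: vector_space tscale by (rule vector_space_tscale)
  note hom = Vector_Spaces.linear.axioms(3)
  note add1 = module_hom.add[OF hom, of s1 "(*)"] and scale1 = module_hom.scale[OF hom, of s1 "(*)"]
  note add2 = module_hom.add[OF hom, of s2 "(*)"] and scale2 = module_hom.scale[OF hom, of s2 "(*)"]
  have "Vector_Spaces.linear s2 tscale (tens s1 s2 v)" for v
  proof unfold_locales
    show "tens s1 s2 v (x + y) = tens s1 s2 v x + tens s1 s2 v y" for x y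
    proof (intro ext)
      fix f g
      show "tens s1 s2 v (x + y) f g = (tens s1 s2 v x + tens s1 s2 v y) f g"
        using add2[of g x y] by (auto simp: tens_def algebra_simps)
    qed
    show "tens s1 s2 v (s2 c x) = tscale c (tens s1 s2 v x)" for c x
    proof (intro ext)
      fix f g
      show "tens s1 s2 v (s2 c x) f g = tscale c (tens s1 s2 v x) f g"
        using scale2[of g c x] by (auto simp: tens_def tscale_def)
    qed
  qed
  moreover have "Vector_Spaces.linear s1 tscale (\<lambda>v. tens s1 s2 v w)" for w
  proof unfold_locales
    show "tens s1 s2 (x + y) w = tens s1 s2 x w + tens s1 s2 y w" for x y
    proof (intro ext)
      fix f g
      show "tens s1 s2 (x + y) w f g = (tens s1 s2 x w + tens s1 s2 y w) f g"
        using add1[of f x y] by (auto simp: tens_def algebra_simps)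
    qed
    show "tens s1 s2 (s1 c x) w = tscale c (tens s1 s2 x w)" for c x
    proof (intro ext)
      fix f g
      show "tens s1 s2 (s1 c x) w f g = tscale c (tens s1 s2 x w) f g"
        using scale1[of f c x] by (auto simp: tens_def tscale_def)
    qed
  qed
  ultimately show ?thesis by (simp add: bilin_def)
qed

lemma linear_coordinate:
  assumes "vector_space s"
  obtains E where "\<And>e. Vector_Spaces.linear s (*) (\<lambda>v. module.representation s E v e)"
    and "\<And>v. finite {e. module.representation s E v e \<noteq> 0}"
    and "\<And>v. (\<Sum>e | module.representation s E v e \<noteq> 0. s (module.representation s E v e) e) = v"
proof -
  interpret v: vector_space s by fact
  let ?E = "v.extend_basis {}"
  have ind: "v.independent ?E" and sp: "v.span ?E = UNIV"
    by (auto simp: v.independent_extend_basis v.independent_empty v.span_extend_basis)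
  interpret m: vector_space "(*) :: 'a \<Rightarrow> 'a \<Rightarrow> 'a" by unfold_locales (auto simp: algebra_simps)
  have "Vector_Spaces.linear s (*) (\<lambda>v. v.representation ?E v e)" for e
    by unfold_locales (simp_all add: v.representation_add[OF ind] v.representation_scale[OF ind] sp)
  with that[of ?E] show thesis
    by (simp add: v.finite_representation v.sum_nonzero_representation_eq[OF ind] sp)
qed

lemma tensor_zero:
  assumes b: "bilin s1 s2 s3 b"
    and zero: "(\<Sum>(v, w)\<leftarrow>ps. tens s1 s2 v w) = 0"
  shows "(\<Sum>(v, w)\<leftarrow>ps. b v w) = 0"
proof -
  have l1: "Vector_Spaces.linear s1 s3 (\<lambda>v. b v w)" and l2: "Vector_Spaces.linear s2 s3 (b v)" for v w
    using b by (auto simp: bilin_def)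
  note lin = Vector_Spaces.linear.axioms(3)
  interpret v1: vector_space s1 using l1 Vector_Spaces.linear.axioms(1) by blast
  interpret v2: vector_space s2 using l2 Vector_Spaces.linear.axioms(1) by blast
  obtain E where E: "\<And>e. Vector_Spaces.linear s1 (*) (\<lambda>v. v1.representation E v e)"
    "\<And>v. finite {e. v1.representation E v e \<noteq> 0}"
    "\<And>v. (\<Sum>e | v1.representation E v e \<noteq> 0. s1 (v1.representation E v e) e) = v"
    by (rule linear_coordinate[OF v1.vector_space_axioms]) blast
  obtain D where D: "\<And>e. Vector_Spaces.linear s2 (*) (\<lambda>v. v2.representation D v e)"
    "\<And>v. finite {e. v2.representation D v e \<noteq> 0}"
    "\<And>v. (\<Sum>e | v2.representation D v e \<noteq> 0. s2 (v2.representation D v e) e) = v"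
    by (rule linear_coordinate[OF v2.vector_space_axioms]) blast
  define r where "r = v1.representation E"
  define F where "F = (\<Union>v\<in>fst ` set ps. {e. r v e \<noteq> 0})"
  have finF: "finite F" using E(2) by (auto simp: F_def r_def)
  have rv: "v = (\<Sum>e\<in>F. s1 (r v e) e)" if "v \<in> fst ` set ps" for v
  proof -
    have "(\<Sum>e | r v e \<noteq> 0. s1 (r v e) e) = (\<Sum>e\<in>F. s1 (r v e) e)"
      by (rule sum.mono_neutral_left) (use finF that in \<open>auto simp: F_def\<close>)
    then show ?thesis using E(3)[of v] by (simp add: r_def)
  qed
  have ev: "(\<Sum>(v, w)\<leftarrow>qs. tens s1 s2 v w) f g = (\<Sum>(v, w)\<leftarrow>qs. f v * g w)"
    if "Vector_Spaces.linear s1 (*) f" "Vector_Spaces.linear s2 (*) g" for f g qs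
    using that by (induction qs) (auto simp: tens_def)
  have coeff: "(\<Sum>(v, w)\<leftarrow>ps. s2 (r v e) w) = 0" (is "?W = 0") for e
  proof -
    have "v2.representation D ?W d = 0" for d
    proof -
      have "v2.representation D (\<Sum>(v, w)\<leftarrow>qs. s2 (r v e) w) d =
          (\<Sum>(v, w)\<leftarrow>qs. r v e * v2.representation D w d)" for qs
        by (induction qs) (auto simp: module_hom.zero[OF lin[OF D(1)]]
            module_hom.add[OF lin[OF D(1)]] module_hom.scale[OF lin[OF D(1)]])
      then show ?thesis
        using ev[OF E(1)[of e] D(1)[of d], of ps] zero by (simp add: r_def)
    qed
    then show ?thesis using D(3)[of ?W] by simp
  qed
  have "(\<Sum>(v, w)\<leftarrow>qs. b v w) = (\<Sum>e\<in>F. b e (\<Sum>(v, w)\<leftarrow>qs. s2 (r v e) w))"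
    if "set qs \<subseteq> set ps" for qs
    using that
  proof (induction qs)
    case Nil
    show ?case by (simp add: module_hom.zero[OF lin[OF l2]])
  next
    case (Cons p qs)
    obtain v w where p: "p = (v, w)" by (cases p)
    have "v \<in> fst ` set ps" using Cons.prems p by force
    then have "b v w = b (\<Sum>e\<in>F. s1 (r v e) e) w" using rv by metis
    also have "\<dots> = (\<Sum>e\<in>F. b e (s2 (r v e) w))"
      by (simp add: module_hom.sum[OF lin[OF l1]] module_hom.scale[OF lin[OF l1]]
          module_hom.scale[OF lin[OF l2]])
    finally show ?case
      using Cons p by (simp add: module_hom.add[OF lin[OF l2]] sum.distrib)
  qed
  then show ?thesis by (simp add: coeff module_hom.zero[OF lin[OF l2]])
qed

lemma sweedler_sum:
  assumes b: "bilin s1 s2 s3 b"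
  shows "sweedler s1 s2 (\<Sum>(v, w)\<leftarrow>ps. tens s1 s2 v w) b = (\<Sum>(v, w)\<leftarrow>ps. b v w)"
proof -
  define qs where
    "qs = (SOME qs. (\<Sum>(v, w)\<leftarrow>ps. tens s1 s2 v w) = (\<Sum>(v, w)\<leftarrow>qs. tens s1 s2 v w))"
  have eq: "(\<Sum>(v, w)\<leftarrow>ps. tens s1 s2 v w) = (\<Sum>(v, w)\<leftarrow>qs. tens s1 s2 v w)"
    unfolding qs_def by (rule someI) (rule refl)
  have neg: "(\<Sum>(v, w)\<leftarrow>map (\<lambda>(v, w). (- v, w)) xs. c v w) = - (\<Sum>(v, w)\<leftarrow>xs. c v w)"
    if "bilin s1 s2 s c" for s c and xs :: "('b \<times> 'c) list"
  proof -
    have "c (- v) w = - c v w" for v w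
      using that module_hom.neg[OF Vector_Spaces.linear.axioms(3)] by (fastforce simp: bilin_def)
    then show ?thesis by (induction xs) auto
  qed
  have "vector_space s1" "vector_space s2"
    using b by (auto simp: bilin_def Vector_Spaces.linear_def)
  then have "(\<Sum>(v, w)\<leftarrow>ps @ map (\<lambda>(v, w). (- v, w)) qs. tens s1 s2 v w) = 0"
    using neg[OF bilin_tens, of qs] eq by (simp del: map_map)
  from tensor_zero[OF b this] have "(\<Sum>(v, w)\<leftarrow>ps. b v w) = (\<Sum>(v, w)\<leftarrow>qs. b v w)"
    using neg[OF b, of qs] by (simp del: map_map)
  then show ?thesis by (simp add: sweedler_def qs_def)
qed

lemma sweedler_tens: "bilin s1 s2 s3 b \<Longrightarrow> sweedler s1 s2 (tens s1 s2 v w) b = b v w"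
  using sweedler_sum[of s1 s2 s3 b "[(v, w)]"] by simp


section \<open>Lie bialgebras\<close>

definition lie_algebra :: "('k::field \<Rightarrow> 'g::ab_group_add \<Rightarrow> 'g) \<Rightarrow> ('g \<Rightarrow> 'g \<Rightarrow> 'g) \<Rightarrow> bool" where
  "lie_algebra s br \<longleftrightarrow> bilin s s s br \<and> (\<forall>x. br x x = 0) \<and>
     (\<forall>x y z. br x (br y z) + br y (br z x) + br z (br x y) = 0)"

text \<open>
  The cobracket takes values in the image of \<open>id - \<tau>\<close>; outside characteristic 2 this is the same as
  \<open>\<tau> \<circ> \<delta> = - \<delta>\<close>, and in general it is dual to the condition \<open>[x, x] = 0\<close>. The last clause is
  co-Jacobi: \<open>(id \<otimes> \<delta>) \<delta> x\<close> has vanishing cyclic sum.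
\<close>

definition lie_coalgebra :: "('k::field \<Rightarrow> 'g::ab_group_add \<Rightarrow> 'g) \<Rightarrow> ('g \<Rightarrow> ('k, 'g, 'g) tensor)
    \<Rightarrow> bool" where
  "lie_coalgebra s \<delta> \<longleftrightarrow> linear_to_tensor s s s \<delta> \<and>
     (\<forall>x. \<exists>u\<in>tensor_space s s. \<delta> x = u - flip u) \<and>
     (\<forall>x. sweedler s s (\<delta> x) (\<lambda>a b. sweedler s s (\<delta> b) (\<lambda>c d.
        tens s tscale a (tens s s c d) + tens s tscale c (tens s s d a)
          + tens s tscale d (tens s s a c))) = 0)"

definition ad_tensor :: "('k::field \<Rightarrow> 'g::ab_group_add \<Rightarrow> 'g) \<Rightarrow> ('g \<Rightarrow> 'g \<Rightarrow> 'g)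
    \<Rightarrow> 'g \<Rightarrow> ('k, 'g, 'g) tensor \<Rightarrow> ('k, 'g, 'g) tensor" where
  "ad_tensor s br x t = sweedler s s t (\<lambda>a b. tens s s (br x a) b + tens s s a (br x b))"

definition lie_bialgebra :: "('k::field \<Rightarrow> 'g::ab_group_add \<Rightarrow> 'g) \<Rightarrow> ('g \<Rightarrow> 'g \<Rightarrow> 'g)
    \<Rightarrow> ('g \<Rightarrow> ('k, 'g, 'g) tensor) \<Rightarrow> bool" where
  "lie_bialgebra s br \<delta> \<longleftrightarrow> lie_algebra s br \<and> lie_coalgebra s \<delta> \<and>
     (\<forall>x y. \<delta> (br x y) = ad_tensor s br x (\<delta> y) - ad_tensor s br y (\<delta> x))"


section \<open>The dual\<close>

text \<open>
  \<open>'d\<close> is the dual space of \<open>'g\<close>: evaluation \<open>ev\<close> identifies it linearly with the linear functionals.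
\<close>

definition dual_space :: "('k::field \<Rightarrow> 'g::ab_group_add \<Rightarrow> 'g) \<Rightarrow> ('k \<Rightarrow> 'd::ab_group_add \<Rightarrow> 'd)
    \<Rightarrow> ('d \<Rightarrow> 'g \<Rightarrow> 'k) \<Rightarrow> bool" where
  "dual_space sg sd ev \<longleftrightarrow> bilin sd sg (*) ev \<and>
     bij_betw ev UNIV {f. Vector_Spaces.linear sg (*) f}"

definition dual_bracket :: "('d \<Rightarrow> 'g \<Rightarrow> 'k) \<Rightarrow> ('g \<Rightarrow> ('k, 'g, 'g) tensor) \<Rightarrow> 'd \<Rightarrow> 'd \<Rightarrow> 'd" where
  "dual_bracket ev \<delta> \<phi> \<psi> = inv ev (\<lambda>x. \<delta> x (ev \<phi>) (ev \<psi>))"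

definition dual_cobracket :: "('k::field \<Rightarrow> 'd::ab_group_add \<Rightarrow> 'd) \<Rightarrow> ('d \<Rightarrow> 'g \<Rightarrow> 'k)
    \<Rightarrow> ('g \<Rightarrow> 'g \<Rightarrow> 'g) \<Rightarrow> 'd \<Rightarrow> ('k, 'd, 'd) tensor" where
  "dual_cobracket sd ev br \<phi> = (THE t. t \<in> tensor_space sd sd \<and>
     (\<forall>x y. t (\<lambda>\<psi>. ev \<psi> x) (\<lambda>\<psi>. ev \<psi> y) = ev \<phi> (br x y)))"

definition coad :: "('d \<Rightarrow> 'g \<Rightarrow> 'k::field) \<Rightarrow> ('g \<Rightarrow> 'g \<Rightarrow> 'g) \<Rightarrow> 'g \<Rightarrow> 'd \<Rightarrow> 'd" where
  "coad ev br x \<phi> = inv ev (\<lambda>y. - ev \<phi> (br x y))"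


section \<open>Crossed modules and braided-Lie bialgebras\<close>

definition lie_module :: "('k::field \<Rightarrow> 'g::ab_group_add \<Rightarrow> 'g) \<Rightarrow> ('g \<Rightarrow> 'g \<Rightarrow> 'g)
    \<Rightarrow> ('k \<Rightarrow> 'v::ab_group_add \<Rightarrow> 'v) \<Rightarrow> ('g \<Rightarrow> 'v \<Rightarrow> 'v) \<Rightarrow> bool" where
  "lie_module sg br sv act \<longleftrightarrow> bilin sg sv sv act \<and>
     (\<forall>x y v. act (br x y) v = act x (act y v) - act y (act x v))"

text \<open>
  \<open>dual_act \<alpha> \<phi> v = \<langle>\<phi>, v\<^sup>1\<rangle> v\<^sup>2\<close>. A coaction is an \<open>\<alpha>\<close> for which this is a left action of the dual with
  the opposite bracket \<open>- [\<phi>, \<psi>]\<close>, where \<open>[\<phi>, \<psi>] = (\<lambda>x. \<delta> x \<phi> \<psi>)\<close>.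
\<close>

definition dual_act :: "('k::field \<Rightarrow> 'g::ab_group_add \<Rightarrow> 'g) \<Rightarrow> ('k \<Rightarrow> 'v::ab_group_add \<Rightarrow> 'v)
    \<Rightarrow> ('v \<Rightarrow> ('k, 'g, 'v) tensor) \<Rightarrow> ('g \<Rightarrow> 'k) \<Rightarrow> 'v \<Rightarrow> 'v" where
  "dual_act sg sv \<alpha> \<phi> v = sweedler sg sv (\<alpha> v) (\<lambda>a u. sv (\<phi> a) u)"

definition lie_comodule :: "('k::field \<Rightarrow> 'g::ab_group_add \<Rightarrow> 'g) \<Rightarrow> ('g \<Rightarrow> ('k, 'g, 'g) tensor)
    \<Rightarrow> ('k \<Rightarrow> 'v::ab_group_add \<Rightarrow> 'v) \<Rightarrow> ('v \<Rightarrow> ('k, 'g, 'v) tensor) \<Rightarrow> bool" where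
  "lie_comodule sg \<delta> sv \<alpha> \<longleftrightarrow> linear_to_tensor sv sg sv \<alpha> \<and>
     (\<forall>\<phi> \<psi> v. Vector_Spaces.linear sg (*) \<phi> \<and> Vector_Spaces.linear sg (*) \<psi> \<longrightarrow>
        dual_act sg sv \<alpha> (\<lambda>x. - \<delta> x \<phi> \<psi>) v =
          dual_act sg sv \<alpha> \<phi> (dual_act sg sv \<alpha> \<psi> v)
          - dual_act sg sv \<alpha> \<psi> (dual_act sg sv \<alpha> \<phi> v))"

definition crossed_module :: "('k::field \<Rightarrow> 'g::ab_group_add \<Rightarrow> 'g) \<Rightarrow> ('g \<Rightarrow> 'g \<Rightarrow> 'g)
    \<Rightarrow> ('g \<Rightarrow> ('k, 'g, 'g) tensor) \<Rightarrow> ('k \<Rightarrow> 'v::ab_group_add \<Rightarrow> 'v) \<Rightarrow> ('g \<Rightarrow> 'v \<Rightarrow> 'v)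
    \<Rightarrow> ('v \<Rightarrow> ('k, 'g, 'v) tensor) \<Rightarrow> bool" where
  "crossed_module sg br \<delta> sv act \<alpha> \<longleftrightarrow>
     lie_module sg br sv act \<and> lie_comodule sg \<delta> sv \<alpha> \<and>
     (\<forall>x v. \<alpha> (act x v) =
        sweedler sg sv (\<alpha> v) (\<lambda>a u. tens sg sv (br x a) u + tens sg sv a (act x u))
        + sweedler sg sg (\<delta> x) (\<lambda>x1 x2. tens sg sv x1 (act x2 v)))"

text \<open>The coaction on \<open>V \<otimes> V\<close>: \<open>v \<otimes> w \<mapsto> v\<^sup>1 \<otimes> (v\<^sup>2 \<otimes> w) + w\<^sup>1 \<otimes> (v \<otimes> w\<^sup>2)\<close>.\<close>

definition coact_tensor :: "('k::field \<Rightarrow> 'g::ab_group_add \<Rightarrow> 'g) \<Rightarrow> ('k \<Rightarrow> 'v::ab_group_add \<Rightarrow> 'v)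
    \<Rightarrow> ('v \<Rightarrow> ('k, 'g, 'v) tensor) \<Rightarrow> ('k, 'v, 'v) tensor \<Rightarrow> ('k, 'g, ('k, 'v, 'v) tensor) tensor" where
  "coact_tensor sg sv \<alpha> t = sweedler sv sv t (\<lambda>v w.
      sweedler sg sv (\<alpha> v) (\<lambda>a u. tens sg tscale a (tens sv sv u w))
    + sweedler sg sv (\<alpha> w) (\<lambda>a u. tens sg tscale a (tens sv sv v u)))"

definition inf_braiding :: "('k::field \<Rightarrow> 'g::ab_group_add \<Rightarrow> 'g) \<Rightarrow> ('k \<Rightarrow> 'b::ab_group_add \<Rightarrow> 'b)
    \<Rightarrow> ('g \<Rightarrow> 'b \<Rightarrow> 'b) \<Rightarrow> ('b \<Rightarrow> ('k, 'g, 'b) tensor) \<Rightarrow> 'b \<Rightarrow> 'b \<Rightarrow> ('k, 'b, 'b) tensor" where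
  "inf_braiding sg sb act \<alpha> x y =
      sweedler sg sb (\<alpha> y) (\<lambda>y1 y2. tens sb sb (act y1 x) y2)
    - sweedler sg sb (\<alpha> x) (\<lambda>x1 x2. tens sb sb (act x1 y) x2)
    - sweedler sg sb (\<alpha> y) (\<lambda>y1 y2. tens sb sb y2 (act y1 x))
    + sweedler sg sb (\<alpha> x) (\<lambda>x1 x2. tens sb sb x2 (act x1 y))"

text \<open>
  Clauses four to seven: the bracket and the cobracket are morphisms of modules and of comodules.
\<close>

definition braided_lie_bialgebra :: "('k::field \<Rightarrow> 'g::ab_group_add \<Rightarrow> 'g) \<Rightarrow> ('g \<Rightarrow> 'g \<Rightarrow> 'g)
    \<Rightarrow> ('g \<Rightarrow> ('k, 'g, 'g) tensor) \<Rightarrow> ('k \<Rightarrow> 'b::ab_group_add \<Rightarrow> 'b) \<Rightarrow> ('b \<Rightarrow> 'b \<Rightarrow> 'b)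
    \<Rightarrow> ('b \<Rightarrow> ('k, 'b, 'b) tensor) \<Rightarrow> ('g \<Rightarrow> 'b \<Rightarrow> 'b) \<Rightarrow> ('b \<Rightarrow> ('k, 'g, 'b) tensor) \<Rightarrow> bool" where
  "braided_lie_bialgebra sg br \<delta> sb brb \<delta>b act \<alpha> \<longleftrightarrow>
     crossed_module sg br \<delta> sb act \<alpha> \<and> lie_algebra sb brb \<and> lie_coalgebra sb \<delta>b \<and>
     (\<forall>x v w. act x (brb v w) = brb (act x v) w + brb v (act x w)) \<and>
     (\<forall>v w. \<alpha> (brb v w) = sweedler sg sb (\<alpha> v) (\<lambda>a u. tens sg sb a (brb u w))
                        + sweedler sg sb (\<alpha> w) (\<lambda>a u. tens sg sb a (brb v u))) \<and>
     (\<forall>x v. \<delta>b (act x v) =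
        sweedler sb sb (\<delta>b v) (\<lambda>p q. tens sb sb (act x p) q + tens sb sb p (act x q))) \<and>
     (\<forall>v. sweedler sg sb (\<alpha> v) (\<lambda>a u. tens sg tscale a (\<delta>b u)) = coact_tensor sg sb \<alpha> (\<delta>b v)) \<and>
     (\<forall>v w. inf_braiding sg sb act \<alpha> v w =
        ad_tensor sb brb v (\<delta>b w) - ad_tensor sb brb w (\<delta>b v) - \<delta>b (brb v w))"


section \<open>Pre-Lie structures\<close>

definition pre_lie_structure :: "('k::field \<Rightarrow> 'd::ab_group_add \<Rightarrow> 'd) \<Rightarrow> ('d \<Rightarrow> 'd \<Rightarrow> 'd)
    \<Rightarrow> ('d \<Rightarrow> 'd \<Rightarrow> 'd) \<Rightarrow> bool" where
  "pre_lie_structure s br \<Xi> \<longleftrightarrow> bilin s s s \<Xi> \<and>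
     (\<forall>\<phi> \<psi> \<zeta>. \<Xi> (\<Xi> \<phi> \<psi>) \<zeta> - \<Xi> (\<Xi> \<psi> \<phi>) \<zeta> = \<Xi> \<phi> (\<Xi> \<psi> \<zeta>) - \<Xi> \<psi> (\<Xi> \<phi> \<zeta>)) \<and>
     (\<forall>\<phi> \<psi>. \<Xi> \<phi> \<psi> - \<Xi> \<psi> \<phi> = br \<phi> \<psi>)"

end

theory Submission
  imports Defs
begin

text \<open>
  Every identity between tensors is tested on functionals. As \<open>\<gg>\<close> is finite-dimensional, the functionals
  on \<open>\<gg>\<^sup>*\<close> are the evaluations at points of \<open>\<gg>\<close>, so with \<open>\<langle>\<alpha>(\<phi>), \<psi> \<otimes> x\<rangle> = - \<Xi>(\<psi>, \<phi>)(x)\<close> each axiom becomes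
  a scalar identity in \<open>\<Xi>\<close>, \<open>ad\<^sup>*\<close> and the bracket. The coaction axiom is then the pre-Lie identity;
  compatibility of the cobracket with the coaction is the covariance
  \<open>\<Xi>(\<phi>, \<psi>)([x, y]) = \<Xi>(\<phi>, ad\<^sup>*\<^sub>y \<psi>)(x) - \<Xi>(\<phi>, ad\<^sup>*\<^sub>x \<psi>)(y)\<close>; and the crossed module condition is the
  sum of the covariance and the last condition, which reads
  \<open>\<Xi>(ad\<^sup>*\<^sub>y \<phi>, \<psi>)(x) = - \<Xi>(ad\<^sup>*\<^sub>x \<psi>, \<phi>)(y)\<close> and also makes the infinitesimal braiding vanish. The bracket on
  the dual of the bisum is that of a semidirect product in which \<open>\<gg>\<^sup>*\<close> acts on \<open>\<gg>\<close> by minus the transpose of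
  \<open>\<Xi>\<close>: the pre-Lie identity makes this an action and the covariance makes it act by derivations.
\<close>

section \<open>Evaluating tensors at functionals\<close>

abbreviation functional :: "('k::field \<Rightarrow> 'v::ab_group_add \<Rightarrow> 'v) \<Rightarrow> ('v \<Rightarrow> 'k) \<Rightarrow> bool" where
  "functional s f \<equiv> Vector_Spaces.linear s (*) f"

lemma vector_space_field: "vector_space ((*) :: 'k::field \<Rightarrow> 'k \<Rightarrow> 'k)"
  by unfold_locales (auto simp: algebra_simps)

lemma linear_iff_hom:
  "Vector_Spaces.linear s1 s2 f \<longleftrightarrow> vector_space s1 \<and> vector_space s2 \<and>
     (\<forall>x y. f (x + y) = f x + f y) \<and> (\<forall>c x. f (s1 c x) = s2 c (f x))"
  by (auto simp: Vector_Spaces.linear_def module_hom_def module_hom_axioms_def module_iff_vector_space)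

lemma functional_iff:
  "functional s f \<longleftrightarrow> vector_space s \<and>
     (\<forall>x y. f (x + y) = f x + f y) \<and> (\<forall>c x. f (s c x) = c * f x)"
  by (auto simp: linear_iff_hom vector_space_field)

lemma functionalD:
  assumes "functional s f"
  shows "vector_space s" "f (x + y) = f x + f y" "f (s c x) = c * f x" "f 0 = 0"
    "f (- x) = - f x" "f (x - y) = f x - f y"
proof -
  interpret Vector_Spaces.linear s "(*)" f by fact
  show "vector_space s" by unfold_locales
  show "f (x + y) = f x + f y" "f (s c x) = c * f x" "f 0 = 0" "f (- x) = - f x" "f (x - y) = f x - f y"
    by (simp_all add: add scale neg diff)
qed

lemma linearD:
  assumes "Vector_Spaces.linear s1 s2 f"
  shows "f (x + y) = f x + f y" "f (s1 c x) = s2 c (f x)" "f 0 = 0"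
    "f (- x) = - f x" "f (x - y) = f x - f y"
proof -
  interpret Vector_Spaces.linear s1 s2 f by fact
  show "f (x + y) = f x + f y" "f (s1 c x) = s2 c (f x)" "f 0 = 0" "f (- x) = - f x" "f (x - y) = f x - f y"
    by (simp_all add: add scale neg diff)
qed

lemma functional_comp:
  "Vector_Spaces.linear s1 s2 h \<Longrightarrow> functional s2 f \<Longrightarrow> functional s1 (\<lambda>x. f (h x))"
  by (auto simp: linear_iff_hom)

lemma functional_uminus: "functional s f \<Longrightarrow> functional s (\<lambda>x. - f x)"
  by (auto simp: linear_iff_hom)

lemma tscale_apply: "tscale c t f g = c * t f g"
  by (simp add: tscale_def)

lemma flip_apply: "flip t f g = t g f"
  by (simp add: flip_def)

lemma uminus_apply: "(- t) f = - t f" for t :: "'v \<Rightarrow> 'u::ab_group_add"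
  by (simp add: fun_Compl_def)

lemmas tensor_apply = tscale_apply flip_apply uminus_apply

lemma tens_apply: "functional s1 f \<Longrightarrow> functional s2 g \<Longrightarrow> tens s1 s2 v w f g = f v * g w"
  by (simp add: tens_def)

lemma tscale_add: "tscale c (t + t') = tscale c t + tscale c t'"
  by (simp add: tensor_apply fun_eq_iff algebra_simps)

lemma flip_add: "flip (t + t') = flip t + flip t'"
  by (simp add: tensor_apply fun_eq_iff)

lemma functional_tensor_eval: "functional tscale (\<lambda>t. t f g)"
  by (auto simp: functional_iff vector_space_tscale tscale_apply)

section \<open>Sweedler sums and additive maps\<close>

lemma sweedler_apply: "sweedler s1 s2 t b f = sweedler s1 s2 t (\<lambda>v w. b v w f)"
proof -
  have "(\<Sum>(v, w)\<leftarrow>ps. b v w) f = (\<Sum>(v, w)\<leftarrow>ps. b v w f)" for ps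
    by (induction ps) auto
  then show ?thesis by (simp add: sweedler_def)
qed

text \<open>The list of pairs chosen inside \<open>sweedler\<close> depends on \<open>t\<close>
  alone, so both sides are sums over the same finite list, whatever \<open>b\<close> is.\<close>

lemma sweedler_hom:
  assumes "F 0 = 0" "\<And>x y. F (x + y) = F x + F y"
  shows "F (sweedler s1 s2 t b) = sweedler s1 s2 t (\<lambda>v w. F (b v w))"
proof -
  have "F (\<Sum>(v, w)\<leftarrow>ps. b v w) = (\<Sum>(v, w)\<leftarrow>ps. F (b v w))" for ps
    by (induction ps) (auto simp: assms)
  then show ?thesis by (simp add: sweedler_def)
qed

lemma sweedler_functional:
  "functional s F \<Longrightarrow> F (sweedler s1 s2 t b) = sweedler s1 s2 t (\<lambda>v w. F (b v w))"
  by (rule sweedler_hom) (simp_all add: functionalD)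

lemma sweedler_add:
  "sweedler s1 s2 t (\<lambda>v w. b v w + c v w) = sweedler s1 s2 t b + sweedler s1 s2 t c"
proof -
  have "(\<Sum>(v, w)\<leftarrow>ps. b v w + c v w) = (\<Sum>(v, w)\<leftarrow>ps. b v w) + (\<Sum>(v, w)\<leftarrow>ps. c v w)" for ps
    by (induction ps) auto
  then show ?thesis by (simp add: sweedler_def)
qed

lemma sweedler_zero: "sweedler s1 s2 t (\<lambda>v w. 0) = 0"
  using sweedler_hom[of "\<lambda>_. 0" s1 s2 t "\<lambda>v w. 0"] by simp

lemma sweedler_mult:
  fixes b :: "'v::ab_group_add \<Rightarrow> 'w::ab_group_add \<Rightarrow> 'k::field"
  shows "sweedler s1 s2 t (\<lambda>v w. k * b v w) = k * sweedler s1 s2 t b"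
  by (rule sweedler_hom[symmetric]) (auto simp: algebra_simps)

lemma sweedler_uminus: "sweedler s1 s2 t (\<lambda>v w. - b v w) = - sweedler s1 s2 t b"
  by (rule sweedler_hom[symmetric]) auto

text \<open>Turns a Sweedler sum back into an evaluation. Membership in \<open>tensor_space\<close>
  ensures that the chosen list does represent \<open>t\<close>. Later computations move functionals
  inside the sum and finish with this rule.\<close>

lemma sweedler_tensor:
  assumes "t \<in> tensor_space s1 s2" "functional s1 f" "functional s2 g"
  shows "sweedler s1 s2 t (\<lambda>v w. f v * g w) = t f g"
proof -
  define ps where "ps = (SOME ps. t = (\<Sum>(v, w)\<leftarrow>ps. tens s1 s2 v w))"
  have "\<exists>ps. t = (\<Sum>(v, w)\<leftarrow>ps. tens s1 s2 v w)"
    using assms(1) by (auto simp: tensor_space_def)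
  then have "t = (\<Sum>(v, w)\<leftarrow>ps. tens s1 s2 v w)"
    unfolding ps_def by (rule someI_ex)
  moreover have "(\<Sum>(v, w)\<leftarrow>qs. tens s1 s2 v w) f g = (\<Sum>(v, w)\<leftarrow>qs. f v * g w)" for qs
    by (induction qs) (auto simp: tens_apply assms)
  moreover have "sweedler s1 s2 t (\<lambda>v w. f v * g w) = (\<Sum>(v, w)\<leftarrow>ps. f v * g w)"
    by (simp add: sweedler_def ps_def)
  ultimately show ?thesis by metis
qed

section \<open>Closure properties of the algebraic tensor product\<close>

lemma tens_in_tensor_space: "tens s1 s2 v w \<in> tensor_space s1 s2"
proof -
  have "tens s1 s2 v w = (\<Sum>(v, w)\<leftarrow>[(v, w)]. tens s1 s2 v w)" by simp
  then show ?thesis unfolding tensor_space_def by blast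
qed

lemma zero_in_tensor_space: "0 \<in> tensor_space s1 s2"
proof -
  have "0 = (\<Sum>(v, w)\<leftarrow>[]. tens s1 s2 v w)" by simp
  then show ?thesis unfolding tensor_space_def by blast
qed

lemma add_in_tensor_space:
  assumes "t \<in> tensor_space s1 s2" "t' \<in> tensor_space s1 s2"
  shows "t + t' \<in> tensor_space s1 s2"
proof -
  obtain ps qs where "t = (\<Sum>(v, w)\<leftarrow>ps. tens s1 s2 v w)" "t' = (\<Sum>(v, w)\<leftarrow>qs. tens s1 s2 v w)"
    using assms by (auto simp: tensor_space_def)
  then have "t + t' = (\<Sum>(v, w)\<leftarrow>ps @ qs. tens s1 s2 v w)" by simp
  then show ?thesis unfolding tensor_space_def by blast
qed

lemma sum_in_tensor_space:
  assumes "\<And>i. i \<in> A \<Longrightarrow> t i \<in> tensor_space s1 s2"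
  shows "sum t A \<in> tensor_space s1 s2"
  using assms
  by (induction A rule: infinite_finite_induct) (auto intro: zero_in_tensor_space add_in_tensor_space)

lemma sweedler_closed:
  assumes "0 \<in> S" "\<And>x y. x \<in> S \<Longrightarrow> y \<in> S \<Longrightarrow> x + y \<in> S" "\<And>v w. b v w \<in> S"
  shows "sweedler s1 s2 t b \<in> S"
proof -
  have "(\<Sum>(v, w)\<leftarrow>ps. b v w) \<in> S" for ps
    by (induction ps) (auto simp: assms)
  then show ?thesis by (simp add: sweedler_def)
qed

lemma sweedler_in_tensor_space:
  "(\<And>v w. b v w \<in> tensor_space s s') \<Longrightarrow> sweedler s1 s2 t b \<in> tensor_space s s'"
  by (rule sweedler_closed) (auto intro: zero_in_tensor_space add_in_tensor_space)

lemma tscale_in_tensor_space: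
  assumes "vector_space s1" "t \<in> tensor_space s1 s2"
  shows "tscale c t \<in> tensor_space s1 s2"
proof -
  obtain ps where t: "t = (\<Sum>(v, w)\<leftarrow>ps. tens s1 s2 v w)"
    using assms(2) by (auto simp: tensor_space_def)
  have *: "tscale c (tens s1 s2 v w) = tens s1 s2 (s1 c v) w" for v w
    by (auto simp: fun_eq_iff tens_def functionalD tscale_apply)
  have "tscale c (\<Sum>(v, w)\<leftarrow>ps. tens s1 s2 v w) \<in> tensor_space s1 s2" for ps
  proof (induction ps)
    case Nil
    have "tscale c 0 = (0 :: ('a, 'b, 'c) tensor)" by (simp add: tensor_apply fun_eq_iff)
    then have "tscale c (\<Sum>(v, w)\<leftarrow>[]. tens s1 s2 v w) = 0" by (simp only: list.map sum_list.Nil)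
    then show ?case by (simp only: zero_in_tensor_space)
  next
    case (Cons p ps)
    then show ?case
      by (auto simp: * tscale_add simp del: plus_fun_apply intro!: add_in_tensor_space tens_in_tensor_space split: prod.split)
  qed
  then show ?thesis by (simp add: t)
qed

lemma minus_in_tensor_space:
  assumes "vector_space s1" "t \<in> tensor_space s1 s2" "t' \<in> tensor_space s1 s2"
  shows "t - t' \<in> tensor_space s1 s2"
proof -
  have "t - t' = t + tscale (-1) t'" by (simp add: tensor_apply fun_eq_iff)
  then show ?thesis using assms by (metis add_in_tensor_space tscale_in_tensor_space)
qed

lemma flip_in_tensor_space:
  assumes "t \<in> tensor_space s1 s2"
  shows "flip t \<in> tensor_space s2 s1"
proof -
  obtain ps where t: "t = (\<Sum>(v, w)\<leftarrow>ps. tens s1 s2 v w)"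
    using assms by (auto simp: tensor_space_def)
  have "flip (\<Sum>(v, w)\<leftarrow>ps. tens s1 s2 v w) = (\<Sum>(v, w)\<leftarrow>map (\<lambda>(v, w). (w, v)) ps. tens s2 s1 v w)"
    for ps
  proof (induction ps)
    case Nil
    show ?case by (simp add: tensor_apply fun_eq_iff)
  next
    case (Cons p ps)
    then show ?case by (auto simp: flip_add flip_tens simp del: plus_fun_apply split: prod.splits)
  qed
  then show ?thesis unfolding t tensor_space_def by blast
qed

section \<open>Separation of tensors by functionals\<close>

lemma tensor_space_vanish:
  assumes "t \<in> tensor_space s1 s2" "\<not> (functional s1 f \<and> functional s2 g)"
  shows "t f g = 0"
proof -
  have "(\<Sum>(v, w)\<leftarrow>ps. tens s1 s2 v w) f g = 0" for ps
    using assms(2) by (induction ps) (auto simp: tens_def)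
  then show ?thesis using assms(1) by (auto simp: tensor_space_def)
qed

lemma tensor_space_eqI:
  assumes "t \<in> tensor_space s1 s2" "t' \<in> tensor_space s1 s2"
    and "\<And>f g. functional s1 f \<Longrightarrow> functional s2 g \<Longrightarrow> t f g = t' f g"
  shows "t = t'"
proof (intro ext)
  fix f g
  show "t f g = t' f g"
    using assms tensor_space_vanish[of t s1 s2 f g] tensor_space_vanish[of t' s1 s2 f g] by metis
qed

text \<open>A tensor is a function of two functions; its linearity in them is inherited from the
  expansion into elementary tensors, reached here through \<open>sweedler_tensor\<close>.\<close>

lemma tensor_space_uminus:
  assumes "t \<in> tensor_space s1 s2" "functional s1 f" "functional s2 g"
  shows "t (\<lambda>x. - f x) g = - t f g" "t f (\<lambda>x. - g x) = - t f g"
proof -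
  note f = functional_uminus[OF assms(2)] and g = functional_uminus[OF assms(3)]
  show "t (\<lambda>x. - f x) g = - t f g"
    using sweedler_tensor[OF assms(1) f assms(3)] by (simp add: sweedler_uminus sweedler_tensor assms)
  show "t f (\<lambda>x. - g x) = - t f g"
    using sweedler_tensor[OF assms(1,2) g] by (simp add: sweedler_uminus sweedler_tensor assms)
qed

text \<open>
  A functional on \<open>s2 \<otimes> s3\<close> need not be a combination of evaluations at pairs of functionals; the
  equality of two triple tensors can nevertheless be tested on evaluations, because contracting the
  first factor gives elements of \<open>tensor_space s2 s3\<close>.
\<close>

definition triple_tensors where
  "triple_tensors s1 s2 s3 = {T. (\<forall>f F. \<not> (functional s1 f \<and> functional tscale F) \<longrightarrow> T f F = 0) \<and>
     (\<forall>f. functional s1 f \<longrightarrow> (\<exists>t\<in>tensor_space s2 s3. \<forall>F. functional tscale F \<longrightarrow> T f F = F t))}"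

lemma tens_in_triple_tensors:
  assumes "vector_space s2" "t \<in> tensor_space s2 s3"
  shows "tens s1 tscale a t \<in> triple_tensors s1 s2 s3"
proof -
  have "\<exists>t'\<in>tensor_space s2 s3. \<forall>F. functional tscale F \<longrightarrow> tens s1 tscale a t f F = F t'"
    if "functional s1 f" for f
    \<comment> \<open>Contracting the first factor with \<open>f\<close> leaves \<open>f a\<close>
      times \<open>t\<close>.\<close>
    by (rule bexI[of _ "tscale (f a) t"])
       (auto simp: tens_apply that functionalD tscale_in_tensor_space assms)
  then show ?thesis by (auto simp: triple_tensors_def tens_def)
qed

lemma zero_in_triple_tensors: "0 \<in> triple_tensors s1 s2 s3"
  by (auto simp: triple_tensors_def functionalD intro!: bexI[of _ 0] zero_in_tensor_space)

lemma add_in_triple_tensors: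
  assumes "T \<in> triple_tensors s1 s2 s3" "T' \<in> triple_tensors s1 s2 s3"
  shows "T + T' \<in> triple_tensors s1 s2 s3"
proof -
  have "\<exists>t\<in>tensor_space s2 s3. \<forall>F. functional tscale F \<longrightarrow> (T + T') f F = F t"
    if f: "functional s1 f" for f
  proof -
    obtain t t' where "t \<in> tensor_space s2 s3" "\<forall>F. functional tscale F \<longrightarrow> T f F = F t"
      and "t' \<in> tensor_space s2 s3" "\<forall>F. functional tscale F \<longrightarrow> T' f F = F t'"
      using assms f unfolding triple_tensors_def by blast
    then show ?thesis by (intro bexI[of _ "t + t'"]) (auto simp: functionalD add_in_tensor_space)
  qed
  moreover have "\<forall>f F. \<not> (functional s1 f \<and> functional tscale F) \<longrightarrow> (T + T') f F = 0"
    using assms unfolding triple_tensors_def by simp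
  ultimately show ?thesis unfolding triple_tensors_def by blast
qed

lemma sweedler_in_triple_tensors:
  "(\<And>v w. b v w \<in> triple_tensors s1 s2 s3) \<Longrightarrow> sweedler s s' t b \<in> triple_tensors s1 s2 s3"
  by (rule sweedler_closed) (auto intro: zero_in_triple_tensors add_in_triple_tensors)

lemma triple_tensors_eqI:
  assumes T: "T \<in> triple_tensors s1 s2 s3" "T' \<in> triple_tensors s1 s2 s3"
    and eq: "\<And>f g h. functional s1 f \<Longrightarrow> functional s2 g \<Longrightarrow> functional s3 h \<Longrightarrow>
          T f (\<lambda>t. t g h) = T' f (\<lambda>t. t g h)"
  shows "T = T'"
proof (intro ext)
  fix f F
  show "T f F = T' f F"
  proof (cases "functional s1 f \<and> functional tscale F")
    case True
    obtain t t' where t: "t \<in> tensor_space s2 s3" "\<forall>F. functional tscale F \<longrightarrow> T f F = F t"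
      and t': "t' \<in> tensor_space s2 s3" "\<forall>F. functional tscale F \<longrightarrow> T' f F = F t'"
      using T True unfolding triple_tensors_def by blast
    have "t g h = t' g h" if "functional s2 g" "functional s3 h" for g h
      using eq[of f g h] t(2) t'(2) True that functional_tensor_eval[of g h] by metis
    then have "t = t'" using t(1) t'(1) by (intro tensor_space_eqI)
    then show ?thesis using t(2) t'(2) True by simp
  next
    case False
    then show ?thesis using T by (simp add: triple_tensors_def)
  qed
qed

text \<open>A new index \<open>a\<close> adds to \<open>u\<close> the row of entries
  \<open>m a b\<close> with \<open>b\<close> already present; the mirrored column is minus the flip
  of that row, and the diagonal entry is 0. There is no division by 2, so characteristic 2 is
  covered.\<close>

lemma alternating_sum_eq_diff_flip:
  assumes "finite A" "\<And>a b. m a b \<in> tensor_space s s" "\<And>a. m a a = 0" "\<And>a b. m b a = - flip (m a b)"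
  shows "\<exists>u\<in>tensor_space s s. (\<Sum>a\<in>A. \<Sum>b\<in>A. m a b) = u - flip u"
  using assms(1)
proof induction
  case empty
  show ?case by (rule bexI[OF _ zero_in_tensor_space]) (simp add: tensor_apply fun_eq_iff)
next
  case (insert a A)
  then obtain u where u: "u \<in> tensor_space s s" "(\<Sum>a\<in>A. \<Sum>b\<in>A. m a b) = u - flip u" by blast
  let ?v = "\<Sum>b\<in>A. m a b"
  have v: "?v \<in> tensor_space s s" by (simp add: sum_in_tensor_space assms(2))
  have "(\<Sum>b\<in>A. m b a) = - flip ?v"
    using insert.hyps(1)
  proof induction
    case empty
    show ?case by (simp add: tensor_apply fun_eq_iff)
  next
    case (insert b A)
    then show ?case by (simp add: assms(4)[of b a] fun_eq_iff tensor_apply)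
  qed
  then have "(\<Sum>x\<in>insert a A. \<Sum>b\<in>insert a A. m x b) = (u + ?v) - flip (u + ?v)"
    using insert.hyps u(2) by (simp add: assms(3) sum.distrib fun_eq_iff tensor_apply)
  with u(1) v show ?case by (metis add_in_tensor_space)
qed

section \<open>Lie coalgebras and Lie bialgebras through their evaluations\<close>

lemma linear_to_tensorI:
  assumes "vector_space s" "\<And>x. \<delta> x \<in> tensor_space s1 s2"
    and "\<And>f g. functional s1 f \<Longrightarrow> functional s2 g \<Longrightarrow> functional s (\<lambda>x. \<delta> x f g)"
  shows "linear_to_tensor s s1 s2 \<delta>"
proof -
  have "\<delta> (x + y) = \<delta> x + \<delta> y" for x y
    by (rule tensor_space_eqI[of _ s1 s2])
       (simp_all add: assms add_in_tensor_space functionalD(2)[OF assms(3)])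
  moreover have "\<delta> (s c x) = tscale c (\<delta> x)" for c x
  proof (intro ext)
    fix f g
    show "\<delta> (s c x) f g = tscale c (\<delta> x) f g"
      using assms(3)[of f g] tensor_space_vanish[OF assms(2), of f g]
      by (cases "functional s1 f \<and> functional s2 g") (auto simp: tscale_apply functionalD(3)[OF assms(3)])
  qed
  ultimately show ?thesis
    using assms(1,2) by (auto simp: linear_to_tensor_def linear_iff_hom vector_space_tscale)
qed

lemma linear_to_tensorD:
  assumes "linear_to_tensor s s1 s2 \<delta>"
  shows "\<delta> x \<in> tensor_space s1 s2" "functional s (\<lambda>x. \<delta> x f g)"
    "\<delta> (x + y) = \<delta> x + \<delta> y" "\<delta> 0 = 0" "\<delta> (s c x) = tscale c (\<delta> x)"
  using assms functional_comp[OF _ functional_tensor_eval, of s \<delta>]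
  by (auto simp: linear_to_tensor_def linearD)

text \<open>In the three cyclic tensors the outer leg \<open>a\<close> meets \<open>f\<close>,
  \<open>h\<close> and \<open>g\<close> in turn; the other two functionals evaluate the inner
  cobracket.\<close>

lemma co_jacobi_apply:
  assumes lin: "linear_to_tensor s s s \<delta>" and f: "functional s f" and g: "functional s g" and h: "functional s h"
  shows "sweedler s s (\<delta> x) (\<lambda>a b. sweedler s s (\<delta> b) (\<lambda>c d.
        tens s tscale a (tens s s c d) + tens s tscale c (tens s s d a)
          + tens s tscale d (tens s s a c))) f (\<lambda>t. t g h)
     = \<delta> x f (\<lambda>b. \<delta> b g h) + \<delta> x h (\<lambda>b. \<delta> b f g) + \<delta> x g (\<lambda>b. \<delta> b h f)"
proof -
  note D = linear_to_tensorD[OF lin]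
  have 1: "sweedler s s (\<delta> b) (\<lambda>c d. k * (f c * g d)) = k * \<delta> b f g"
    if "functional s f" "functional s g" for b k f g
    by (simp add: sweedler_mult sweedler_tensor D that)
  have 2: "sweedler s s (\<delta> b) (\<lambda>c d. f c * (g d * h a)) = h a * \<delta> b f g" for a b
    using 1[OF f g, of b "h a"] by (simp add: ac_simps)
  have 3: "sweedler s s (\<delta> b) (\<lambda>c d. f d * (g a * h c)) = g a * \<delta> b h f" for a b
    using 1[OF h f, of b "g a"] by (simp add: ac_simps)
  show ?thesis
    by (simp add: sweedler_apply tens_apply f g h functional_tensor_eval 1 2 3 sweedler_add
        sweedler_tensor D)
qed

text \<open>The way back from scalars to a vanishing triple tensor is
  \<open>triple_tensors_eqI\<close>. In this form the axioms are verified for the dual and for the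
  bisum.\<close>

lemma lie_coalgebra_iff:
  "lie_coalgebra s \<delta> \<longleftrightarrow> linear_to_tensor s s s \<delta> \<and>
     (\<forall>x. \<exists>u\<in>tensor_space s s. \<delta> x = u - flip u) \<and>
     (\<forall>x f g h. functional s f \<longrightarrow> functional s g \<longrightarrow> functional s h \<longrightarrow>
        \<delta> x f (\<lambda>b. \<delta> b g h) + \<delta> x h (\<lambda>b. \<delta> b f g) + \<delta> x g (\<lambda>b. \<delta> b h f) = 0)"
proof -
  let ?T = "\<lambda>x. sweedler s s (\<delta> x) (\<lambda>a b. sweedler s s (\<delta> b) (\<lambda>c d.
        tens s tscale a (tens s s c d) + tens s tscale c (tens s s d a)
          + tens s tscale d (tens s s a c)))"
  have "(\<forall>x. ?T x = 0) \<longleftrightarrow> (\<forall>x f g h. functional s f \<longrightarrow> functional s g \<longrightarrow> functional s h \<longrightarrow>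
        \<delta> x f (\<lambda>b. \<delta> b g h) + \<delta> x h (\<lambda>b. \<delta> b f g) + \<delta> x g (\<lambda>b. \<delta> b h f) = 0)" (is "?L \<longleftrightarrow> ?R")
    if lin: "linear_to_tensor s s s \<delta>"
  proof
    assume ?L
    then show ?R using co_jacobi_apply[OF lin] by simp
  next
    assume R: ?R
    have s: "vector_space s" using lin by (simp add: linear_to_tensor_def linear_iff_hom)
    show ?L
    proof
      fix x
      show "?T x = 0"
        by (rule triple_tensors_eqI[of _ s s s])
           (use R in \<open>simp_all add: sweedler_in_triple_tensors add_in_triple_tensors
            tens_in_triple_tensors tens_in_tensor_space s zero_in_triple_tensors co_jacobi_apply[OF lin]\<close>)
    qed
  qed
  then show ?thesis unfolding lie_coalgebra_def by blast
qed

lemma bilinD: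
  assumes "bilin s1 s2 s3 b"
  shows "Vector_Spaces.linear s2 s3 (b v)" "Vector_Spaces.linear s1 s3 (\<lambda>v. b v w)"
    "b (v + v') w = b v w + b v' w" "b v (w + w') = b v w + b v w'"
    "b (v - v') w = b v w - b v' w" "b v (w - w') = b v w - b v w'"
    "b (- v) w = - b v w" "b v (- w) = - b v w" "b 0 w = 0" "b v 0 = 0"
    "b (s1 c v) w = s3 c (b v w)" "b v (s2 c w) = s3 c (b v w)"
proof -
  show l: "Vector_Spaces.linear s2 s3 (b v)" "Vector_Spaces.linear s1 s3 (\<lambda>v. b v w)" for v w
    using assms by (auto simp: bilin_def)
  show "b (v + v') w = b v w + b v' w" "b v (w + w') = b v w + b v w'"
    "b (v - v') w = b v w - b v' w" "b v (w - w') = b v w - b v w'"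
    "b (- v) w = - b v w" "b v (- w) = - b v w" "b 0 w = 0" "b v 0 = 0"
    "b (s1 c v) w = s3 c (b v w)" "b v (s2 c w) = s3 c (b v w)"
    using linearD[OF l(1)] linearD[OF l(2)] by auto
qed

lemma sweedler_derivation_apply:
  assumes "t \<in> tensor_space s1 s2" "Vector_Spaces.linear s1 s1 h" "Vector_Spaces.linear s2 s2 k"
    and "functional s1 f" "functional s2 g"
  shows "sweedler s1 s2 t (\<lambda>a b. tens s1 s2 (h a) b + tens s1 s2 a (k b)) f g
    = t (\<lambda>a. f (h a)) g + t f (\<lambda>b. g (k b))"
  by (simp add: sweedler_apply tens_apply assms sweedler_add sweedler_tensor functional_comp[OF assms(2)]
      functional_comp[OF assms(3)])

lemma ad_tensor_apply:
  assumes "bilin s s s br" "t \<in> tensor_space s s" "functional s f" "functional s g"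
  shows "ad_tensor s br x t f g = t (\<lambda>a. f (br x a)) g + t f (\<lambda>b. g (br x b))"
  unfolding ad_tensor_def by (rule sweedler_derivation_apply) (use assms bilinD in auto)

lemma ad_tensor_in_tensor_space: "ad_tensor s br x t \<in> tensor_space s s"
  unfolding ad_tensor_def by (intro sweedler_in_tensor_space add_in_tensor_space tens_in_tensor_space)

text \<open>The scalar form of the cocycle condition serves twice: to extract \<open>cocycle\<close>
  from the given Lie bialgebra and to establish the condition for the bisum.\<close>

lemma lie_bialgebra_iff:
  "lie_bialgebra s br \<delta> \<longleftrightarrow> lie_algebra s br \<and> lie_coalgebra s \<delta> \<and>
     (\<forall>x y f g. functional s f \<longrightarrow> functional s g \<longrightarrow>
        \<delta> (br x y) f g = \<delta> y (\<lambda>a. f (br x a)) g + \<delta> y f (\<lambda>a. g (br x a))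
          - (\<delta> x (\<lambda>a. f (br y a)) g + \<delta> x f (\<lambda>a. g (br y a))))"
proof -
  have "(\<forall>x y. \<delta> (br x y) = ad_tensor s br x (\<delta> y) - ad_tensor s br y (\<delta> x)) \<longleftrightarrow>
     (\<forall>x y f g. functional s f \<longrightarrow> functional s g \<longrightarrow>
        \<delta> (br x y) f g = \<delta> y (\<lambda>a. f (br x a)) g + \<delta> y f (\<lambda>a. g (br x a))
          - (\<delta> x (\<lambda>a. f (br y a)) g + \<delta> x f (\<lambda>a. g (br y a))))" (is "?L \<longleftrightarrow> ?R")
    if A: "lie_algebra s br" "lie_coalgebra s \<delta>"
  proof
    have b: "bilin s s s br" using A by (simp add: lie_algebra_def)
    have d: "\<delta> x \<in> tensor_space s s" for x
      using A linear_to_tensorD(1) unfolding lie_coalgebra_def by blast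
    have s: "vector_space s" using b by (simp add: bilin_def linear_iff_hom)
    show ?R if ?L
      using that by (simp add: ad_tensor_apply b d)
    show ?L if ?R
      by (intro allI tensor_space_eqI[of _ s s])
         (use that in \<open>simp_all add: ad_tensor_apply b d minus_in_tensor_space s ad_tensor_in_tensor_space\<close>)
  qed
  then show ?thesis unfolding lie_bialgebra_def by blast
qed

section \<open>Duality\<close>

locale dual_pair = finite_dimensional_vector_space sg B
  for sg :: "'k::field \<Rightarrow> 'g::ab_group_add \<Rightarrow> 'g" and B :: "'g set" +
  fixes sd :: "'k \<Rightarrow> 'd::ab_group_add \<Rightarrow> 'd" and ev :: "'d \<Rightarrow> 'g \<Rightarrow> 'k"
  assumes dual: "dual_space sg sd ev"
begin

lemma bilin_ev: "bilin sd sg (*) ev"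
  using dual by (simp add: dual_space_def)

lemmas ev_simps = bilinD(3-12)[OF bilin_ev]

lemma functional_ev: "functional sg (ev \<phi>)"
  by (rule bilinD[OF bilin_ev])

lemma functional_pt: "functional sd (\<lambda>\<phi>. ev \<phi> x)"
  by (rule bilinD[OF bilin_ev])

lemma vector_space_sd: "vector_space sd"
  by (rule functionalD[OF functional_pt])

lemma vector_space_sg: "vector_space sg"
  by (rule functionalD[OF functional_ev])

lemma inv_ev: "functional sg f \<Longrightarrow> ev (inv ev f) = f"
  using dual by (auto simp: dual_space_def bij_betw_def intro!: f_inv_into_f)

lemma functional_sgE:
  assumes "functional sg f"
  obtains \<phi> where "f = ev \<phi>"
  using inv_ev[OF assms] by metis

lemma ev_eqI: "(\<And>x. ev \<phi> x = ev \<psi> x) \<Longrightarrow> \<phi> = \<psi>"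
  using dual by (metis dual_space_def bij_betw_def injD ext)

lemma ev_sum: "ev (sum F A) x = (\<Sum>a\<in>A. ev (F a) x)"
  by (induction A rule: infinite_finite_induct) (auto simp: ev_simps)

text \<open>The basis dual to \<open>B\<close>, as elements of \<open>'d\<close>.\<close>

definition coord :: "'g \<Rightarrow> 'd" where
  "coord b = inv ev (\<lambda>x. representation B x b)"

lemma ev_coord: "ev (coord b) x = representation B x b"
  unfolding coord_def by (subst inv_ev) (simp_all add: linear_representation independent_Basis span_Basis)

lemma basis_expansion: "(\<Sum>b\<in>B. sg (ev (coord b) x) b) = x"
  by (simp add: ev_coord sum_representation_eq independent_Basis span_Basis finite_Basis)

lemma functional_basis_expansion:
  assumes "functional sg f"
  shows "f x = (\<Sum>b\<in>B. ev (coord b) x * f b)"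
proof -
  have "f (sum F A) = (\<Sum>a\<in>A. f (F a))" for F :: "'g \<Rightarrow> 'g" and A
    by (induction A rule: infinite_finite_induct) (auto simp: functionalD[OF assms])
  then show ?thesis
    using arg_cong[OF basis_expansion[of x], of f] by (simp add: functionalD[OF assms])
qed

text \<open>Reflexivity. Expanding every \<open>\<phi>\<close> in the dual basis and applying
  \<open>f\<close> shows that \<open>f\<close> is evaluation at the point with coordinate
  \<open>f (coord b)\<close> at each \<open>b\<close>.\<close>

lemma functional_sdE:
  assumes f: "functional sd f"
  obtains x where "f = (\<lambda>\<phi>. ev \<phi> x)"
proof
  have sum: "f (sum F A) = (\<Sum>a\<in>A. f (F a))" for F :: "'g \<Rightarrow> 'd" and A
    by (induction A rule: infinite_finite_induct) (auto simp: functionalD[OF f])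
  have "\<phi> = (\<Sum>b\<in>B. sd (ev \<phi> b) (coord b))" for \<phi>
  proof (rule ev_eqI)
    show "ev \<phi> x = ev (\<Sum>b\<in>B. sd (ev \<phi> b) (coord b)) x" for x
      using functional_basis_expansion[OF functional_ev, of \<phi> x] by (simp add: ev_sum ev_simps mult.commute)
  qed
  then have "f \<phi> = f (\<Sum>b\<in>B. sd (ev \<phi> b) (coord b))" for \<phi>
    by (rule arg_cong)
  moreover have "f (\<Sum>b\<in>B. sd (ev \<phi> b) (coord b)) = (\<Sum>b\<in>B. ev \<phi> b * f (coord b))" for \<phi>
    by (simp add: sum functionalD[OF f])
  ultimately have 1: "f \<phi> = (\<Sum>b\<in>B. ev \<phi> b * f (coord b))" for \<phi>
    by (rule trans)
  have 2: "ev \<phi> (sum F A) = (\<Sum>a\<in>A. ev \<phi> (F a))" for \<phi> and F :: "'g \<Rightarrow> 'g" and A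
    by (induction A rule: infinite_finite_induct) (auto simp: ev_simps)
  show "f = (\<lambda>\<phi>. ev \<phi> (\<Sum>b\<in>B. sg (f (coord b)) b))"
    by (rule ext, subst 1) (simp add: 2 ev_simps mult.commute)
qed

lemma tensor_space_dd_eqI:
  assumes "t \<in> tensor_space sd sd" "t' \<in> tensor_space sd sd"
    and "\<And>x y. t (\<lambda>\<phi>. ev \<phi> x) (\<lambda>\<phi>. ev \<phi> y) = t' (\<lambda>\<phi>. ev \<phi> x) (\<lambda>\<phi>. ev \<phi> y)"
  shows "t = t'"
proof (rule tensor_space_eqI[OF assms(1,2)])
  fix f g
  assume "functional sd f" "functional sd g"
  then obtain x y where "f = (\<lambda>\<phi>. ev \<phi> x)" "g = (\<lambda>\<phi>. ev \<phi> y)" by (elim functional_sdE) blast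
  then show "t f g = t' f g" by (simp add: assms(3))
qed

lemma tensor_space_gd_eqI:
  assumes "t \<in> tensor_space sg sd" "t' \<in> tensor_space sg sd"
    and "\<And>\<psi> y. t (ev \<psi>) (\<lambda>\<phi>. ev \<phi> y) = t' (ev \<psi>) (\<lambda>\<phi>. ev \<phi> y)"
  shows "t = t'"
proof (rule tensor_space_eqI[OF assms(1,2)])
  fix f g
  assume "functional sg f" "functional sd g"
  then obtain \<psi> y where "f = ev \<psi>" "g = (\<lambda>\<phi>. ev \<phi> y)" by (elim functional_sdE functional_sgE) blast
  then show "t f g = t' f g" by (simp add: assms(3))
qed

lemma tensor_space_dd_eq_iff:
  assumes "t \<in> tensor_space sd sd" "t' \<in> tensor_space sd sd"
  shows "t = t' \<longleftrightarrow> (\<forall>x y. t (\<lambda>\<phi>. ev \<phi> x) (\<lambda>\<phi>. ev \<phi> y) = t' (\<lambda>\<phi>. ev \<phi> x) (\<lambda>\<phi>. ev \<phi> y))"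
  by (rule iffI, simp, rule tensor_space_dd_eqI[OF assms], simp)

lemma tensor_space_gd_eq_iff:
  assumes "t \<in> tensor_space sg sd" "t' \<in> tensor_space sg sd"
  shows "t = t' \<longleftrightarrow> (\<forall>\<psi> y. t (ev \<psi>) (\<lambda>\<phi>. ev \<phi> y) = t' (ev \<psi>) (\<lambda>\<phi>. ev \<phi> y))"
  by (rule iffI, simp, rule tensor_space_gd_eqI[OF assms], simp)

section \<open>Bilinear forms on the Lie algebra as tensors over its dual\<close>

definition form_entry :: "('g \<Rightarrow> 'g \<Rightarrow> 'k) \<Rightarrow> 'g \<Rightarrow> 'g \<Rightarrow> ('k, 'd, 'd) tensor" where
  "form_entry \<omega> a b = tscale (\<omega> a b) (tens sd sd (coord a) (coord b))"

lemma form_entry_in_tensor_space: "form_entry \<omega> a b \<in> tensor_space sd sd"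
  by (simp add: form_entry_def tscale_in_tensor_space vector_space_sd tens_in_tensor_space)

text \<open>Both arguments of \<open>\<omega>\<close> are expanded in the basis. The resulting
  tensor provides the existence half of the definite description in
  \<open>dual_cobracket\<close>.\<close>

lemma form_tensor_apply:
  assumes "bilin sg sg (*) \<omega>"
  shows "(\<Sum>a\<in>B. \<Sum>b\<in>B. form_entry \<omega> a b) (\<lambda>\<phi>. ev \<phi> x) (\<lambda>\<phi>. ev \<phi> y) = \<omega> x y"
proof -
  have sum: "sum F A f = (\<Sum>a\<in>A. F a f)" for F :: "'g \<Rightarrow> 'x \<Rightarrow> 'y::comm_monoid_add" and A f
    by (induction A rule: infinite_finite_induct) auto
  have "\<omega> x y = (\<Sum>a\<in>B. ev (coord a) x * \<omega> a y)"
    by (rule functional_basis_expansion) (rule bilinD[OF assms])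
  also have "\<dots> = (\<Sum>a\<in>B. ev (coord a) x * (\<Sum>b\<in>B. ev (coord b) y * \<omega> a b))"
    by (subst functional_basis_expansion[of "\<omega> a" for a]) (auto intro: bilinD[OF assms])
  finally show ?thesis
    by (simp add: sum form_entry_def tscale_apply tens_apply functional_pt sum_distrib_left ac_simps)
qed

lemma alternating_form_tensor:
  assumes "bilin sg sg (*) \<omega>" "\<And>x. \<omega> x x = 0"
  shows "\<exists>u\<in>tensor_space sd sd. (\<Sum>a\<in>B. \<Sum>b\<in>B. form_entry \<omega> a b) = u - flip u"
proof (rule alternating_sum_eq_diff_flip)
  show "form_entry \<omega> a a = 0" for a
    by (simp add: form_entry_def assms(2) tscale_apply fun_eq_iff)
  have swap: "\<omega> x y = - \<omega> y x" for x y
    using assms(2)[of "x + y"] assms(2)[of x] assms(2)[of y]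
    by (simp add: bilinD[OF assms(1)] eq_neg_iff_add_eq_0 add.commute)
  show "form_entry \<omega> b a = - flip (form_entry \<omega> a b)" for a b
    using swap[of b a] flip_tens[of sd sd "coord a" "coord b"]
    by (simp add: form_entry_def fun_eq_iff tensor_apply)
qed (simp_all add: form_entry_in_tensor_space finite_Basis)

end

section \<open>The dual of a Lie bialgebra and the coadjoint action\<close>

locale lie_bialgebra_dual = dual_pair sg B sd ev
  for sg :: "'k::field \<Rightarrow> 'g::ab_group_add \<Rightarrow> 'g" and B and sd :: "'k \<Rightarrow> 'd::ab_group_add \<Rightarrow> 'd" and ev +
  fixes br :: "'g \<Rightarrow> 'g \<Rightarrow> 'g" and \<delta> :: "'g \<Rightarrow> ('k, 'g, 'g) tensor"
  assumes lie: "lie_bialgebra sg br \<delta>"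
begin

abbreviation "ad \<equiv> coad ev br"
abbreviation "dbr \<equiv> dual_bracket ev \<delta>"
abbreviation "dcobr \<equiv> dual_cobracket sd ev br"

lemma bilin_br: "bilin sg sg sg br"
  using lie by (simp add: lie_bialgebra_def lie_algebra_def)

lemmas br_simps = bilinD(3-12)[OF bilin_br]

lemma br_self: "br x x = 0"
  using lie by (simp add: lie_bialgebra_def lie_algebra_def)

lemma br_swap: "br x y = - br y x"
proof -
  have "br x x + br y x + (br x y + br y y) = 0"
    using br_self[of "x + y"] by (simp only: br_simps(1,2))
  then show ?thesis by (simp add: br_self eq_neg_iff_add_eq_0 add.commute)
qed

lemma jacobi: "br x (br y z) + br y (br z x) + br z (br x y) = 0"
  using lie by (simp add: lie_bialgebra_def lie_algebra_def)

text \<open>The Jacobi identity read as: the adjoint action is a representation. Its transpose is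
  \<open>coad_br\<close>.\<close>

lemma br_br: "br (br x y) z = br x (br y z) - br y (br x z)"
proof -
  have "br (br x y) z = - br z (br x y)" "br y (br z x) = - br y (br x z)"
    using br_swap[of "br x y" z] br_swap[of z x] by (simp_all add: br_simps)
  then show ?thesis using jacobi[of x y z] by (simp add: algebra_simps add_eq_0_iff2)
qed

lemma delta: "linear_to_tensor sg sg sg \<delta>"
  using lie by (simp add: lie_bialgebra_def lie_coalgebra_def)

lemma ev_coad: "ev (ad x \<phi>) y = - ev \<phi> (br x y)"
  unfolding coad_def
  by (subst inv_ev) (rule functional_uminus functional_comp[OF bilinD(1)[OF bilin_br]] functional_ev refl)+

lemma ev_br_eq: "(\<lambda>a. ev \<phi> (br x a)) = ev (- ad x \<phi>)"
  by (simp add: fun_eq_iff ev_simps ev_coad)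

text \<open>Antisymmetry trades the acting element \<open>a\<close> for \<open>y\<close>, so the
  dependence on \<open>a\<close> is again given by an element of the dual. This makes Sweedler sums
  computable when a tensor leg acts.\<close>

lemma ev_coad_left_eq: "(\<lambda>a. ev (ad a \<phi>) y) = ev (- ad y \<phi>)"
proof
  show "ev (ad a \<phi>) y = ev (- ad y \<phi>) a" for a
    using br_swap[of a y] by (simp add: ev_simps ev_coad)
qed

lemma bilin_coad: "bilin sg sd sd ad"
  by (auto simp: bilin_def linear_iff_hom vector_space_sg vector_space_sd ev_coad ev_simps br_simps
      intro!: ev_eqI)

lemmas coad_simps = bilinD(3-12)[OF bilin_coad]

lemma coad_br: "ad (br x y) \<phi> = ad x (ad y \<phi>) - ad y (ad x \<phi>)"
  by (rule ev_eqI) (simp add: ev_coad ev_simps br_br)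

lemma ev_dual_bracket: "ev (dbr \<phi> \<psi>) x = \<delta> x (ev \<phi>) (ev \<psi>)"
  unfolding dual_bracket_def by (subst inv_ev) (rule linear_to_tensorD[OF delta] refl)+

lemma bilin_ev_br: "bilin sg sg (*) (\<lambda>x y. ev \<phi> (br x y))"
  by (auto simp: bilin_def functional_iff vector_space_sg ev_simps br_simps)

lemma dual_cobracket_eq: "dcobr \<phi> = (\<Sum>a\<in>B. \<Sum>b\<in>B. form_entry (\<lambda>x y. ev \<phi> (br x y)) a b)"
  unfolding dual_cobracket_def
proof (rule the_equality)
  let ?t = "\<Sum>a\<in>B. \<Sum>b\<in>B. form_entry (\<lambda>x y. ev \<phi> (br x y)) a b"
  show t: "?t \<in> tensor_space sd sd \<and>
      (\<forall>x y. ?t (\<lambda>\<psi>. ev \<psi> x) (\<lambda>\<psi>. ev \<psi> y) = ev \<phi> (br x y))"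
    by (simp add: sum_in_tensor_space form_entry_in_tensor_space form_tensor_apply bilin_ev_br)
  show "t = ?t" if "t \<in> tensor_space sd sd \<and>
      (\<forall>x y. t (\<lambda>\<psi>. ev \<psi> x) (\<lambda>\<psi>. ev \<psi> y) = ev \<phi> (br x y))" for t
    by (rule tensor_space_dd_eqI) (use that t in auto)
qed

lemma dual_cobracket_in_tensor_space: "dcobr \<phi> \<in> tensor_space sd sd"
  by (simp add: dual_cobracket_eq sum_in_tensor_space form_entry_in_tensor_space)

lemma dual_cobracket_apply: "dcobr \<phi> (\<lambda>\<psi>. ev \<psi> x) (\<lambda>\<psi>. ev \<psi> y) = ev \<phi> (br x y)"
  by (simp add: dual_cobracket_eq form_tensor_apply bilin_ev_br)

text \<open>Contracting the second leg of the cobracket with a point is the coadjoint action of that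
  point; contracting the first leg, in the next lemma, gives the opposite sign by
  antisymmetry.\<close>

lemma dual_cobracket_apply_right:
  assumes "functional sd f"
  shows "dcobr \<psi> f (\<lambda>\<chi>. ev \<chi> y) = f (ad y \<psi>)"
proof -
  obtain x where "f = (\<lambda>\<chi>. ev \<chi> x)" using assms by (rule functional_sdE)
  then show ?thesis using br_swap[of x y] by (simp add: dual_cobracket_apply ev_coad ev_simps)
qed

lemma dual_cobracket_apply_left:
  assumes "functional sd f"
  shows "dcobr \<psi> (\<lambda>\<chi>. ev \<chi> x) f = - f (ad x \<psi>)"
proof -
  obtain y where "f = (\<lambda>\<chi>. ev \<chi> y)" using assms by (rule functional_sdE)
  then show ?thesis by (simp add: dual_cobracket_apply ev_coad)
qed

lemma linear_dual_cobracket: "linear_to_tensor sd sd sd dcobr"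
proof (rule linear_to_tensorI)
  show "functional sd (\<lambda>\<phi>. dcobr \<phi> f g)" if fg: "functional sd f" "functional sd g" for f g
  proof -
    obtain x y where "f = (\<lambda>\<chi>. ev \<chi> x)" "g = (\<lambda>\<chi>. ev \<chi> y)" using functional_sdE[OF fg(1)] functional_sdE[OF fg(2)] by metis
    then show ?thesis by (simp add: dual_cobracket_apply functional_pt)
  qed
qed (simp_all add: vector_space_sd dual_cobracket_in_tensor_space)

text \<open>Each axiom is the transpose of one for \<open>br\<close>: \<open>br_self\<close> yields
  the form \<open>u - flip u\<close>, and co-Jacobi at three points is the Jacobi identity under
  \<open>ev \<phi>\<close>.\<close>

lemma lie_coalgebra_dual: "lie_coalgebra sd dcobr"
  unfolding lie_coalgebra_iff
proof (intro conjI allI impI)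
  show "linear_to_tensor sd sd sd dcobr" by (rule linear_dual_cobracket)
  show "\<exists>u\<in>tensor_space sd sd. dcobr \<phi> = u - flip u" for \<phi>
    unfolding dual_cobracket_eq by (rule alternating_form_tensor) (simp_all add: bilin_ev_br br_self ev_simps)
  show "dcobr \<phi> f (\<lambda>b. dcobr b g h) + dcobr \<phi> h (\<lambda>b. dcobr b f g) + dcobr \<phi> g (\<lambda>b. dcobr b h f) = 0"
    if fgh: "functional sd f" "functional sd g" "functional sd h" for \<phi> f g h
  proof -
    obtain x y z where "f = (\<lambda>\<chi>. ev \<chi> x)" "g = (\<lambda>\<chi>. ev \<chi> y)" "h = (\<lambda>\<chi>. ev \<chi> z)"
      using functional_sdE[OF fgh(1)] functional_sdE[OF fgh(2)] functional_sdE[OF fgh(3)] by metis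
    then show ?thesis
      using arg_cong[OF jacobi[of x y z], of "ev \<phi>"]
      by (simp add: dual_cobracket_apply ev_simps algebra_simps)
  qed
qed

lemma coad_lie_module: "lie_module sg br sd ad"
  by (simp add: lie_module_def bilin_coad coad_br)

lemma functional_ev_coad: "functional sd (\<lambda>\<phi>. ev (ad x \<phi>) y)"
  by (rule functional_comp[OF bilinD(1)[OF bilin_coad] functional_pt])

text \<open>Evaluated at two points, this too is the Jacobi identity under
  \<open>ev \<phi>\<close>.\<close>

lemma dual_cobracket_coad:
  "dcobr (ad x \<phi>) = sweedler sd sd (dcobr \<phi>) (\<lambda>p q. tens sd sd (ad x p) q + tens sd sd p (ad x q))"
proof (rule tensor_space_dd_eqI)
  show "dcobr (ad x \<phi>) (\<lambda>\<phi>. ev \<phi> y) (\<lambda>\<phi>. ev \<phi> z) =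
    sweedler sd sd (dcobr \<phi>) (\<lambda>p q. tens sd sd (ad x p) q + tens sd sd p (ad x q))
      (\<lambda>\<phi>. ev \<phi> y) (\<lambda>\<phi>. ev \<phi> z)" for y z
  proof -
    have "ev \<phi> (br z (br x y)) = - ev \<phi> (br x (br y z)) + ev \<phi> (br y (br x z))"
      using br_swap[of z "br x y"] by (simp add: br_br ev_simps)
    then show ?thesis
    by (simp add: sweedler_derivation_apply dual_cobracket_in_tensor_space bilinD(1)[OF bilin_coad] functional_pt
        dual_cobracket_apply_left dual_cobracket_apply_right functional_ev_coad)
       (simp add: dual_cobracket_apply ev_coad)
  qed
qed (intro dual_cobracket_in_tensor_space sweedler_in_tensor_space add_in_tensor_space tens_in_tensor_space)+

text \<open>The compatibility of \<open>\<delta>\<close> with \<open>br\<close>, moved to the dual: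
  \<open>br x\<close> inside an argument of \<open>\<delta>\<close> becomes minus the coadjoint
  action of \<open>x\<close>.\<close>

lemma cocycle:
  "ev (dbr \<phi> \<psi>) (br x y) = - ev (dbr (ad x \<phi>) \<psi>) y - ev (dbr \<phi> (ad x \<psi>)) y
     + ev (dbr (ad y \<phi>) \<psi>) x + ev (dbr \<phi> (ad y \<psi>)) x"
proof -
  note D = linear_to_tensorD[OF delta]
  have 1: "(\<lambda>a. ev \<phi> (br x a)) = (\<lambda>a. - ev (ad x \<phi>) a)" for \<phi> x
    by (simp add: ev_coad)
  have "\<delta> (br x y) (ev \<phi>) (ev \<psi>) = \<delta> y (\<lambda>a. ev \<phi> (br x a)) (ev \<psi>) + \<delta> y (ev \<phi>) (\<lambda>a. ev \<psi> (br x a))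
          - (\<delta> x (\<lambda>a. ev \<phi> (br y a)) (ev \<psi>) + \<delta> x (ev \<phi>) (\<lambda>a. ev \<psi> (br y a)))"
    using lie functional_ev unfolding lie_bialgebra_iff by blast
  then show ?thesis
    by (simp add: 1 ev_dual_bracket tensor_space_uminus[OF D(1)] functional_ev algebra_simps)
qed

end

section \<open>The coaction defined by a splitting of the dual bracket\<close>

locale split_dual_bracket = lie_bialgebra_dual sg B sd ev br \<delta>
  for sg :: "'k::field \<Rightarrow> 'g::ab_group_add \<Rightarrow> 'g" and B and sd :: "'k \<Rightarrow> 'd::ab_group_add \<Rightarrow> 'd"
    and ev and br and \<delta> +
  fixes \<Xi> :: "'d \<Rightarrow> 'd \<Rightarrow> 'd" and \<alpha> :: "'d \<Rightarrow> ('k, 'g, 'd) tensor"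
  assumes bilin_Xi: "bilin sd sd sd \<Xi>"
    and Xi_split: "\<Xi> \<phi> \<psi> - \<Xi> \<psi> \<phi> = dual_bracket ev \<delta> \<phi> \<psi>"
    and alpha: "linear_to_tensor sd sg sd \<alpha>"
    and alpha_apply: "\<alpha> \<phi> (ev \<psi>) (\<lambda>\<chi>. ev \<chi> x) = - ev (\<Xi> \<psi> \<phi>) x"
begin

lemmas Xi_simps = bilinD(3-12)[OF bilin_Xi]

lemmas dbr_eq = Xi_split[symmetric]

lemma delta_apply: "\<delta> x (ev \<phi>) (ev \<psi>) = ev (\<Xi> \<phi> \<psi>) x - ev (\<Xi> \<psi> \<phi>) x"
  by (simp add: ev_dual_bracket[symmetric] dbr_eq ev_simps)

lemmas alpha_in_tensor_space = linear_to_tensorD(1)[OF alpha]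
lemmas delta_in_tensor_space = linear_to_tensorD(1)[OF delta]

lemma alpha_apply_functional:
  assumes "functional sd f"
  shows "\<alpha> \<phi> (ev \<psi>) f = - f (\<Xi> \<psi> \<phi>)"
proof -
  obtain x where "f = (\<lambda>\<chi>. ev \<chi> x)" using assms by (rule functional_sdE)
  then show ?thesis by (simp add: alpha_apply)
qed

lemma functional_ev_Xi: "functional sd (\<lambda>\<phi>. ev (\<Xi> \<phi> \<psi>) x)" "functional sd (\<lambda>\<psi>. ev (\<Xi> \<phi> \<psi>) x)"
  by (rule functional_comp[OF bilinD(2)[OF bilin_Xi] functional_pt]
      functional_comp[OF bilinD(1)[OF bilin_Xi] functional_pt])+

lemma functional_ev_coad_left: "functional sg (\<lambda>a. ev (ad a \<phi>) y)"
  unfolding ev_coad_left_eq by (rule functional_ev)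

text \<open>The coaction thus encodes the operators \<open>- \<Xi> \<psi>\<close>, so conditions on
  \<alpha> become conditions on \<Xi>.\<close>

lemma dual_act_eq: "dual_act sg sd \<alpha> (ev \<psi>) \<phi> = - \<Xi> \<psi> \<phi>"
proof (rule ev_eqI)
  show "ev (dual_act sg sd \<alpha> (ev \<psi>) \<phi>) x = ev (- \<Xi> \<psi> \<phi>) x" for x
    unfolding dual_act_def
    by (subst sweedler_functional[OF functional_pt])
      (simp add: ev_simps sweedler_tensor alpha_in_tensor_space functional_ev functional_pt alpha_apply)
qed

section \<open>The three conditions on \<Xi> as scalar identities\<close>

definition pre_Lie :: bool where
  "pre_Lie \<longleftrightarrow> (\<forall>\<phi> \<psi> \<zeta>. \<Xi> (\<Xi> \<phi> \<psi> - \<Xi> \<psi> \<phi>) \<zeta> = \<Xi> \<phi> (\<Xi> \<psi> \<zeta>) - \<Xi> \<psi> (\<Xi> \<phi> \<zeta>))"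

text \<open>Each \<open>\<Xi> \<phi>\<close> commutes with the cobracket as a derivation; evaluation
  at \<open>x\<close> and \<open>y\<close> has turned the contracted legs into coadjoint
  actions.\<close>

definition covariant :: bool where
  "covariant \<longleftrightarrow> (\<forall>\<phi> \<psi> x y. ev (\<Xi> \<phi> \<psi>) (br x y) = ev (\<Xi> \<phi> (ad y \<psi>)) x - ev (\<Xi> \<phi> (ad x \<psi>)) y)"

text \<open>The expression changes sign when the pair \<open>\<phi>\<close>, \<open>y\<close> is
  exchanged with the pair \<open>\<psi>\<close>, \<open>x\<close>.\<close>

definition exchange :: bool where
  "exchange \<longleftrightarrow> (\<forall>\<phi> \<psi> x y. ev (\<Xi> (ad y \<phi>) \<psi>) x = - ev (\<Xi> (ad x \<psi>) \<phi>) y)"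

text \<open>Collecting the two terms on the left of the pre-Lie identity makes it say that \<Xi> is
  a representation of the dual Lie algebra on itself.\<close>

lemma pre_lie_structure_iff: "pre_lie_structure sd dbr \<Xi> \<longleftrightarrow> pre_Lie"
  by (simp add: pre_lie_structure_def pre_Lie_def bilin_Xi Xi_split[symmetric] Xi_simps)

lemma covariant_iff:
  "covariant \<longleftrightarrow> (\<forall>\<phi> \<psi>. dcobr (\<Xi> \<phi> \<psi>) =
     sweedler sd sd (dcobr \<psi>) (\<lambda>\<psi>1 \<psi>2. tens sd sd (\<Xi> \<phi> \<psi>1) \<psi>2)
     + sweedler sd sd (dcobr \<psi>) (\<lambda>\<psi>1 \<psi>2. tens sd sd \<psi>1 (\<Xi> \<phi> \<psi>2)))" (is "_ \<longleftrightarrow> (\<forall>\<phi> \<psi>. _ = ?r \<phi> \<psi>)")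
proof -
  have r: "?r \<phi> \<psi> (\<lambda>\<chi>. ev \<chi> x) (\<lambda>\<chi>. ev \<chi> y) = ev (\<Xi> \<phi> (ad y \<psi>)) x - ev (\<Xi> \<phi> (ad x \<psi>)) y"
    for \<phi> \<psi> x y
    by (simp add: sweedler_apply tens_apply functional_pt sweedler_tensor dual_cobracket_in_tensor_space
        functional_ev_Xi dual_cobracket_apply_left dual_cobracket_apply_right)
  have "?r \<phi> \<psi> \<in> tensor_space sd sd" for \<phi> \<psi>
    by (intro add_in_tensor_space sweedler_in_tensor_space tens_in_tensor_space)
  then have "dcobr (\<Xi> \<phi> \<psi>) = ?r \<phi> \<psi> \<longleftrightarrow>
      (\<forall>x y. ev (\<Xi> \<phi> \<psi>) (br x y) = ev (\<Xi> \<phi> (ad y \<psi>)) x - ev (\<Xi> \<phi> (ad x \<psi>)) y)" for \<phi> \<psi>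
    by (simp only: tensor_space_dd_eq_iff[OF dual_cobracket_in_tensor_space] r dual_cobracket_apply)
  then show ?thesis by (simp add: covariant_def)
qed

lemma exchange_iff:
  "exchange \<longleftrightarrow> (\<forall>\<phi> \<psi>. sweedler sd sd (dcobr \<phi>) (\<lambda>\<phi>1 \<phi>2. tens sd sd (\<Xi> \<phi>1 \<psi>) \<phi>2) =
     sweedler sd sd (dcobr \<psi>) (\<lambda>\<psi>1 \<psi>2. tens sd sd \<psi>1 (\<Xi> \<psi>2 \<phi>)))" (is "_ \<longleftrightarrow> (\<forall>\<phi> \<psi>. ?l \<phi> \<psi> = ?r \<phi> \<psi>)")
proof -
  have l: "?l \<phi> \<psi> (\<lambda>\<chi>. ev \<chi> x) (\<lambda>\<chi>. ev \<chi> y) = ev (\<Xi> (ad y \<phi>) \<psi>) x"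
    and r: "?r \<phi> \<psi> (\<lambda>\<chi>. ev \<chi> x) (\<lambda>\<chi>. ev \<chi> y) = - ev (\<Xi> (ad x \<psi>) \<phi>) y" for \<phi> \<psi> x y
    by (simp_all add: sweedler_apply tens_apply functional_pt sweedler_tensor dual_cobracket_in_tensor_space
        functional_ev_Xi dual_cobracket_apply_left dual_cobracket_apply_right)
  have "?l \<phi> \<psi> \<in> tensor_space sd sd" "?r \<phi> \<psi> \<in> tensor_space sd sd" for \<phi> \<psi>
    by (intro sweedler_in_tensor_space tens_in_tensor_space)+
  then have "?l \<phi> \<psi> = ?r \<phi> \<psi> \<longleftrightarrow> (\<forall>x y. ev (\<Xi> (ad y \<phi>) \<psi>) x = - ev (\<Xi> (ad x \<psi>) \<phi>) y)" for \<phi> \<psi>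
    by (simp only: tensor_space_dd_eq_iff l r)
  then show ?thesis by (simp add: exchange_def)
qed

section \<open>The axioms of a braided-Lie bialgebra in terms of \<Xi>\<close>

lemma comodule_iff: "lie_comodule sg \<delta> sd \<alpha> \<longleftrightarrow> pre_Lie"
proof -
  have "(\<lambda>x. - \<delta> x (ev \<phi>) (ev \<psi>)) = ev (- (\<Xi> \<phi> \<psi> - \<Xi> \<psi> \<phi>))" for \<phi> \<psi>
    by (simp add: delta_apply ev_simps fun_eq_iff)
  \<comment> \<open>The sign of the opposite bracket cancels the sign in \<open>dual_act_eq\<close>.
    In the composed actions on the other side of the axiom two such signs cancel.\<close>
  then have 1: "dual_act sg sd \<alpha> (\<lambda>x. - \<delta> x (ev \<phi>) (ev \<psi>)) \<zeta> = \<Xi> (\<Xi> \<phi> \<psi> - \<Xi> \<psi> \<phi>) \<zeta>" for \<phi> \<psi> \<zeta>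
    by (simp only: dual_act_eq) (simp add: Xi_simps)
  have "(\<forall>\<phi> \<psi>. functional sg \<phi> \<and> functional sg \<psi> \<longrightarrow> P \<phi> \<psi>) \<longleftrightarrow> (\<forall>\<phi> \<psi>. P (ev \<phi>) (ev \<psi>))" for P
    using functional_ev functional_sgE by metis
  then show ?thesis
    unfolding lie_comodule_def pre_Lie_def by (simp add: alpha 1 dual_act_eq Xi_simps)
qed

text \<open>The identity is arranged so that its left side is the defect of covariance and its right
  side the defect of the exchange condition.\<close>

lemma crossed_iff:
  "(\<forall>x v. \<alpha> (ad x v) =
      sweedler sg sd (\<alpha> v) (\<lambda>a u. tens sg sd (br x a) u + tens sg sd a (ad x u))
      + sweedler sg sg (\<delta> x) (\<lambda>x1 x2. tens sg sd x1 (ad x2 v))) \<longleftrightarrow>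
   (\<forall>\<phi> \<psi> x y. ev (\<Xi> \<psi> \<phi>) (br x y) + ev (\<Xi> \<psi> (ad x \<phi>)) y - ev (\<Xi> \<psi> (ad y \<phi>)) x
      = - ev (\<Xi> (ad x \<psi>) \<phi>) y - ev (\<Xi> (ad y \<phi>) \<psi>) x)" (is "(\<forall>x v. _ = ?r x v) \<longleftrightarrow> _")
proof -
  have r: "?r x \<phi> (ev \<psi>) (\<lambda>\<chi>. ev \<chi> y) = ev (\<Xi> (ad x \<psi>) \<phi>) y + ev (\<Xi> \<psi> \<phi>) (br x y)
      + ev (\<Xi> (ad y \<phi>) \<psi>) x - ev (\<Xi> \<psi> (ad y \<phi>)) x" for x \<phi> \<psi> y
    by (simp add: sweedler_derivation_apply alpha_in_tensor_space bilinD(1)[OF bilin_br]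
        bilinD(1)[OF bilin_coad] functional_ev functional_pt)
      (simp add: sweedler_apply tens_apply functional_ev functional_pt sweedler_tensor delta_in_tensor_space
        functional_ev_coad_left functional_ev_coad alpha_apply_functional ev_br_eq ev_coad_left_eq
        delta_apply ev_simps Xi_simps, simp add: ev_coad)
  have "?r x \<phi> \<in> tensor_space sg sd" for x \<phi>
    by (intro add_in_tensor_space sweedler_in_tensor_space tens_in_tensor_space)
  then have "\<alpha> (ad x \<phi>) = ?r x \<phi> \<longleftrightarrow>
      (\<forall>\<psi> y. - ev (\<Xi> \<psi> (ad x \<phi>)) y = ev (\<Xi> (ad x \<psi>) \<phi>) y + ev (\<Xi> \<psi> \<phi>) (br x y)
      + ev (\<Xi> (ad y \<phi>) \<psi>) x - ev (\<Xi> \<psi> (ad y \<phi>)) x)" for x \<phi>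
    by (simp only: tensor_space_gd_eq_iff[OF alpha_in_tensor_space] r alpha_apply)
  moreover have "- ev (\<Xi> \<psi> (ad x \<phi>)) y = ev (\<Xi> (ad x \<psi>) \<phi>) y + ev (\<Xi> \<psi> \<phi>) (br x y)
      + ev (\<Xi> (ad y \<phi>) \<psi>) x - ev (\<Xi> \<psi> (ad y \<phi>)) x \<longleftrightarrow>
    ev (\<Xi> \<psi> \<phi>) (br x y) + ev (\<Xi> \<psi> (ad x \<phi>)) y - ev (\<Xi> \<psi> (ad y \<phi>)) x
      = - ev (\<Xi> (ad x \<psi>) \<phi>) y - ev (\<Xi> (ad y \<phi>) \<psi>) x" for \<phi> \<psi> x y
    by (auto simp: algebra_simps eq_neg_iff_add_eq_0 neg_eq_iff_add_eq_0)
  ultimately show ?thesis by blast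
qed

text \<open>Contracting the leg in the Lie algebra with \<open>\<psi>\<close> turns the coaction on
  the tensor square into \<open>- \<Xi> \<psi>\<close> acting as a derivation.\<close>

lemma colinear_cobracket_iff:
  "(\<forall>v. sweedler sg sd (\<alpha> v) (\<lambda>a u. tens sg tscale a (dcobr u)) = coact_tensor sg sd \<alpha> (dcobr v))
    \<longleftrightarrow> covariant" (is "(\<forall>v. ?l v = ?r v) \<longleftrightarrow> _")
proof -
  have l: "?l \<phi> (ev \<psi>) (\<lambda>t. t (\<lambda>\<chi>. ev \<chi> x) (\<lambda>\<chi>. ev \<chi> y)) = - ev (\<Xi> \<psi> \<phi>) (br x y)" for \<phi> \<psi> x y
    by (simp add: sweedler_apply tens_apply functional_ev functional_pt functional_tensor_eval
        dual_cobracket_apply sweedler_tensor alpha_in_tensor_space alpha_apply)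
  \<comment> \<open>Here \<open>k\<close> is the value on the tensor leg that is not coacted upon;
    facts 1 and 2 are the orders of the factors that evaluation produces.\<close>
  have 0: "sweedler sg sd (\<alpha> v) (\<lambda>a u. k * (ev \<psi> a * ev u x)) = k * - ev (\<Xi> \<psi> v) x" for v \<psi> x k
    by (simp add: sweedler_mult sweedler_tensor alpha_in_tensor_space functional_ev functional_pt alpha_apply)
  have 1: "sweedler sg sd (\<alpha> v) (\<lambda>a u. ev \<psi> a * (ev u x * k)) = - ev (\<Xi> \<psi> v) x * k"
    and 2: "sweedler sg sd (\<alpha> v) (\<lambda>a u. ev \<psi> a * (k * ev u x)) = k * - ev (\<Xi> \<psi> v) x" for v \<psi> x k
    using 0[of v k \<psi> x] by (simp_all add: ac_simps)
  have r: "?r \<phi> (ev \<psi>) (\<lambda>t. t (\<lambda>\<chi>. ev \<chi> x) (\<lambda>\<chi>. ev \<chi> y))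
      = - (ev (\<Xi> \<psi> (ad y \<phi>)) x - ev (\<Xi> \<psi> (ad x \<phi>)) y)" for \<phi> \<psi> x y
    by (simp add: coact_tensor_def sweedler_apply tens_apply functional_ev functional_pt functional_tensor_eval
        1 2 sweedler_add sweedler_uminus sweedler_tensor dual_cobracket_in_tensor_space functional_ev_Xi
        dual_cobracket_apply_left dual_cobracket_apply_right)
  have "?l \<phi> = ?r \<phi>"
    if "\<And>\<psi> x y. - ev (\<Xi> \<psi> \<phi>) (br x y) = - (ev (\<Xi> \<psi> (ad y \<phi>)) x - ev (\<Xi> \<psi> (ad x \<phi>)) y)" for \<phi>
  proof (rule triple_tensors_eqI)
    show "?l \<phi> \<in> triple_tensors sg sd sd"
      by (intro sweedler_in_triple_tensors tens_in_triple_tensors vector_space_sd dual_cobracket_in_tensor_space)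
    show "?r \<phi> \<in> triple_tensors sg sd sd"
      unfolding coact_tensor_def
      by (intro sweedler_in_triple_tensors add_in_triple_tensors tens_in_triple_tensors vector_space_sd
          tens_in_tensor_space)
    fix f g h
    assume f: "functional sg f" and g: "functional sd g" and h: "functional sd h"
    obtain \<psi> x y where "f = ev \<psi>" "g = (\<lambda>\<chi>. ev \<chi> x)" "h = (\<lambda>\<chi>. ev \<chi> y)"
      by (metis functional_sgE[OF f] functional_sdE[OF g] functional_sdE[OF h])
    then show "?l \<phi> f (\<lambda>t. t g h) = ?r \<phi> f (\<lambda>t. t g h)"
      using l r that by simp
  qed
  moreover have "- ev (\<Xi> \<psi> \<phi>) (br x y) = - (ev (\<Xi> \<psi> (ad y \<phi>)) x - ev (\<Xi> \<psi> (ad x \<phi>)) y)"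
    if "?l \<phi> = ?r \<phi>" for \<phi> \<psi> x y
    using l[of \<phi> \<psi> x y] r[of \<phi> \<psi> x y] unfolding that by (rule trans[OF sym])
  ultimately have "?l \<phi> = ?r \<phi> \<longleftrightarrow>
      (\<forall>\<psi> x y. - ev (\<Xi> \<psi> \<phi>) (br x y) = - (ev (\<Xi> \<psi> (ad y \<phi>)) x - ev (\<Xi> \<psi> (ad x \<phi>)) y))" for \<phi>
    by blast
  then show ?thesis
    unfolding covariant_def neg_equal_iff_equal by blast
qed

text \<open>Evaluation turns the four terms into values of \<Xi>; by the exchange condition the
  first cancels the fourth and the second cancels the third.\<close>

lemma inf_braiding_zero:
  assumes "exchange"
  shows "inf_braiding sg sd ad \<alpha> \<phi> \<psi> = 0"
proof (rule tensor_space_dd_eqI)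
  show "inf_braiding sg sd ad \<alpha> \<phi> \<psi> \<in> tensor_space sd sd"
    unfolding inf_braiding_def
    by (intro add_in_tensor_space minus_in_tensor_space vector_space_sd sweedler_in_tensor_space
        tens_in_tensor_space)
  have 1: "sweedler sg sd (\<alpha> \<psi>) (\<lambda>a u. ev (ad a \<phi>) x * ev u y) = ev (\<Xi> (ad x \<phi>) \<psi>) y"
    for \<phi> \<psi> x y
    by (simp add: sweedler_tensor alpha_in_tensor_space functional_ev_coad_left functional_pt)
      (simp add: ev_coad_left_eq alpha_apply Xi_simps ev_simps)
  have 2: "sweedler sg sd (\<alpha> \<psi>) (\<lambda>a u. ev u y * ev (ad a \<phi>) x) = ev (\<Xi> (ad x \<phi>) \<psi>) y"
    for \<phi> \<psi> x y
    using 1[of \<psi> \<phi> x y] by (simp add: mult.commute)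
  show "inf_braiding sg sd ad \<alpha> \<phi> \<psi> (\<lambda>\<chi>. ev \<chi> x) (\<lambda>\<chi>. ev \<chi> y) = 0 (\<lambda>\<chi>. ev \<chi> x) (\<lambda>\<chi>. ev \<chi> y)" for x y
    using assms[unfolded exchange_def, rule_format, of x \<phi> \<psi> y]
      assms[unfolded exchange_def, rule_format, of y \<phi> \<psi> x]
    by (simp add: inf_braiding_def sweedler_apply tens_apply functional_pt 1 2)
qed (rule zero_in_tensor_space)

text \<open>For the zero bracket the clauses about the bracket are trivial and the braiding clause
  asks for \<open>inf_braiding\<close> to vanish. The three conditions come from the comodule axiom,
  the colinearity of the cobracket and the crossed module identity.\<close>

lemma braided_iff:
  "braided_lie_bialgebra sg br \<delta> sd (\<lambda>_ _. 0) dcobr ad \<alpha> \<longleftrightarrow> pre_Lie \<and> covariant \<and> exchange"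
proof -
  have tens_zero: "tens s s' a 0 = 0" "tens s s' 0 b = 0" for s :: "'k \<Rightarrow> 'x::ab_group_add \<Rightarrow> 'x"
    and s' :: "'k \<Rightarrow> 'y::ab_group_add \<Rightarrow> 'y" and a b
    by (auto simp: tens_def fun_eq_iff functionalD)
  interpret dual: vector_space sd by (rule vector_space_sd)
  have zero: "lie_algebra sd (\<lambda>_ _. 0)"
    by (simp add: lie_algebra_def bilin_def linear_iff_hom vector_space_sd)
  have dz: "dcobr 0 = 0" "\<alpha> 0 = 0"
    by (rule linear_to_tensorD[OF linear_dual_cobracket] linear_to_tensorD[OF alpha])+
  \<comment> \<open>Covariance annihilates the left side of the crossed module identity; what
    remains is the exchange condition.\<close>
  have "covariant \<Longrightarrow> exchange \<longleftrightarrow>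
    (\<forall>\<phi> \<psi> x y. ev (\<Xi> \<psi> \<phi>) (br x y) + ev (\<Xi> \<psi> (ad x \<phi>)) y - ev (\<Xi> \<psi> (ad y \<phi>)) x
      = - ev (\<Xi> (ad x \<psi>) \<phi>) y - ev (\<Xi> (ad y \<phi>) \<psi>) x)"
    by (auto simp: covariant_def exchange_def eq_neg_iff_add_eq_0 algebra_simps)
  then show ?thesis
    unfolding braided_lie_bialgebra_def crossed_module_def comodule_iff crossed_iff colinear_cobracket_iff
    by (auto simp: coad_lie_module zero lie_coalgebra_dual coad_simps dz sweedler_zero tens_zero
        dual_cobracket_coad inf_braiding_zero ad_tensor_def)
qed

section \<open>The bisum\<close>

abbreviation "E \<equiv> module_prod.scale sd sg"

definition bisum_bracket :: "'d \<times> 'g \<Rightarrow> 'd \<times> 'g \<Rightarrow> 'd \<times> 'g" where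
  "bisum_bracket = (\<lambda>(\<phi>, x) (\<psi>, y). (ad x \<psi> - ad y \<phi>, br x y))"

definition bisum_cobracket :: "'d \<times> 'g \<Rightarrow> ('k, 'd \<times> 'g, 'd \<times> 'g) tensor" where
  "bisum_cobracket = (\<lambda>(\<phi>, X).
     sweedler sg sg (\<delta> X) (\<lambda>x1 x2. tens E E (0, x1) (0, x2))
     + sweedler sd sd (dcobr \<phi>) (\<lambda>\<phi>1 \<phi>2. tens E E (\<phi>1, 0) (\<phi>2, 0))
     + (let t = sweedler sg sd (\<alpha> \<phi>) (\<lambda>a \<chi>. tens E E (0, a) (\<chi>, 0))
        in t - flip t))"

text \<open>The dual of the bisum again consists of a point and a dual vector, with crossed roles:
  \<open>p\<close> pairs with the dual component and \<open>\<pi>\<close> with the other.\<close>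

definition pair_ev :: "'g \<Rightarrow> 'd \<Rightarrow> 'd \<times> 'g \<Rightarrow> 'k" where
  "pair_ev p \<pi> v = ev (fst v) p + ev \<pi> (snd v)"

lemma E_apply: "E c (\<phi>, x) = (sd c \<phi>, sg c x)"
proof -
  interpret vector_space_prod sd sg
    by (simp add: vector_space_prod_def vector_space_pair_def vector_space_sd vector_space_sg)
  show ?thesis by (rule scale_prod)
qed

lemma vector_space_E: "vector_space E"
proof -
  interpret vector_space_prod sd sg
    by (simp add: vector_space_prod_def vector_space_pair_def vector_space_sd vector_space_sg)
  show ?thesis by unfold_locales
qed

lemma functional_pair_ev: "functional E (pair_ev p \<pi>)"
  by (auto simp: functional_iff vector_space_E pair_ev_def E_apply ev_simps algebra_simps)

text \<open>A functional is the sum of its restrictions to the two summands; the restriction to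
  \<open>'d\<close> is a point by reflexivity.\<close>

lemma functional_EE:
  assumes f: "functional E f"
  obtains p \<pi> where "f = pair_ev p \<pi>"
proof -
  interpret dual: vector_space sd by (rule vector_space_sd)
  note F = functionalD[OF f]
  have "functional sd (\<lambda>\<phi>. f (\<phi>, 0))" "functional sg (\<lambda>x. f (0, x))"
    using F(2)[of "(_, 0)" "(_, 0)"] F(3)[of _ "(_, 0)"] F(2)[of "(0, _)" "(0, _)"] F(3)[of _ "(0, _)"]
    by (simp_all add: functional_iff vector_space_sd vector_space_sg E_apply)
  then obtain p \<pi> where p: "(\<lambda>\<phi>. f (\<phi>, 0)) = (\<lambda>\<phi>. ev \<phi> p)" and \<pi>: "(\<lambda>x. f (0, x)) = ev \<pi>"
    by (metis functional_sdE functional_sgE)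
  have "f v = pair_ev p \<pi> v" for v
    using F(2)[of "(fst v, 0)" "(0, snd v)"] fun_cong[OF p, of "fst v"] fun_cong[OF \<pi>, of "snd v"]
    by (simp add: pair_ev_def)
  then show thesis using that by blast
qed

text \<open>As a function of the pairs \<open>p\<close>, \<open>\<pi>\<close> and \<open>q\<close>,
  \<open>\<kappa>\<close> this is the bracket on the dual of the bisum, paired with
  \<open>\<phi>\<close>, \<open>X\<close>; all later verifications use this formula.\<close>

lemma bisum_cobracket_apply:
  "bisum_cobracket (\<phi>, X) (pair_ev p \<pi>) (pair_ev q \<kappa>) =
     ev (\<Xi> \<pi> \<kappa>) X - ev (\<Xi> \<kappa> \<pi>) X + ev \<phi> (br p q) - ev (\<Xi> \<pi> \<phi>) q + ev (\<Xi> \<kappa> \<phi>) p"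
proof -
  have 1: "pair_ev p \<pi> (0, x) = ev \<pi> x" "pair_ev p \<pi> (\<phi>, 0) = ev \<phi> p" for p \<pi> x \<phi>
    by (simp_all add: pair_ev_def ev_simps)
  show ?thesis
    by (simp add: bisum_cobracket_def Let_def flip_apply sweedler_apply tens_apply functional_pair_ev 1
        sweedler_tensor delta_in_tensor_space alpha_in_tensor_space dual_cobracket_in_tensor_space
        functional_ev functional_pt delta_apply dual_cobracket_apply alpha_apply)
qed

lemma bisum_cobracket_in_tensor_space: "bisum_cobracket v \<in> tensor_space E E"
  unfolding bisum_cobracket_def Let_def split_beta
  by (intro add_in_tensor_space minus_in_tensor_space flip_in_tensor_space sweedler_in_tensor_space
      tens_in_tensor_space vector_space_E)

lemma tensor_space_E_eqI:
  assumes "t \<in> tensor_space E E" "t' \<in> tensor_space E E"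
    and "\<And>p \<pi> q \<kappa>. t (pair_ev p \<pi>) (pair_ev q \<kappa>) = t' (pair_ev p \<pi>) (pair_ev q \<kappa>)"
  shows "t = t'"
proof (rule tensor_space_eqI[OF assms(1,2)])
  fix f g
  assume f: "functional E f" and g: "functional E g"
  obtain p \<pi> where "f = pair_ev p \<pi>" by (rule functional_EE[OF f])
  moreover obtain q \<kappa> where "g = pair_ev q \<kappa>" by (rule functional_EE[OF g])
  ultimately show "t f g = t' f g" by (simp add: assms(3))
qed

lemma linear_bisum_cobracket: "linear_to_tensor E E E bisum_cobracket"
proof (rule linear_to_tensorI)
  fix f g
  assume f: "functional E f" and g: "functional E g"
  obtain p \<pi> where fp: "f = pair_ev p \<pi>" by (rule functional_EE[OF f])
  obtain q \<kappa> where gq: "g = pair_ev q \<kappa>" by (rule functional_EE[OF g])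
  show "functional E (\<lambda>v. bisum_cobracket v f g)"
    by (auto simp: functional_iff fp gq bisum_cobracket_apply vector_space_E E_apply Xi_simps ev_simps
        algebra_simps)
qed (simp_all add: vector_space_E bisum_cobracket_in_tensor_space)

text \<open>The witness adds preimages of \<open>\<delta> X\<close> and \<open>dcobr \<phi>\<close>
  under \<open>id - flip\<close>, carried into the bisum, to the term from \<alpha>, which enters
  the cobracket already in the form \<open>t - flip t\<close>.\<close>

lemma bisum_cobracket_skew: "\<exists>u\<in>tensor_space E E. bisum_cobracket v = u - flip u"
proof -
  obtain \<phi> X where v: "v = (\<phi>, X)" by (cases v)
  obtain u1 where u1: "u1 \<in> tensor_space sg sg" "\<delta> X = u1 - flip u1"
    using lie unfolding lie_bialgebra_def lie_coalgebra_def by blast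
  obtain u2 where u2: "u2 \<in> tensor_space sd sd" "dcobr \<phi> = u2 - flip u2"
    using lie_coalgebra_dual unfolding lie_coalgebra_def by blast
  let ?u = "sweedler sg sg u1 (\<lambda>x1 x2. tens E E (0, x1) (0, x2))
     + sweedler sd sd u2 (\<lambda>\<phi>1 \<phi>2. tens E E (\<phi>1, 0) (\<phi>2, 0))
     + sweedler sg sd (\<alpha> \<phi>) (\<lambda>a \<chi>. tens E E (0, a) (\<chi>, 0))"
  have 1: "pair_ev p \<pi> (0, x) = ev \<pi> x" "pair_ev p \<pi> (\<phi>, 0) = ev \<phi> p" for p \<pi> x \<phi>
    by (simp_all add: pair_ev_def ev_simps)
  have u: "?u \<in> tensor_space E E"
    by (intro add_in_tensor_space sweedler_in_tensor_space tens_in_tensor_space)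
  have "bisum_cobracket v = ?u - flip ?u"
  proof (rule tensor_space_E_eqI)
    show "?u - flip ?u \<in> tensor_space E E"
      by (intro minus_in_tensor_space flip_in_tensor_space u vector_space_E)
    fix p \<pi> q \<kappa>
    have "ev (\<Xi> \<pi> \<kappa>) X - ev (\<Xi> \<kappa> \<pi>) X = u1 (ev \<pi>) (ev \<kappa>) - u1 (ev \<kappa>) (ev \<pi>)"
      unfolding delta_apply[symmetric] u1(2) by (simp add: flip_apply)
    moreover have "ev \<phi> (br p q) = u2 (\<lambda>\<chi>. ev \<chi> p) (\<lambda>\<chi>. ev \<chi> q) - u2 (\<lambda>\<chi>. ev \<chi> q) (\<lambda>\<chi>. ev \<chi> p)"
      unfolding dual_cobracket_apply[symmetric] u2(2) by (simp add: flip_apply)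
    ultimately show "bisum_cobracket v (pair_ev p \<pi>) (pair_ev q \<kappa>) = (?u - flip ?u) (pair_ev p \<pi>) (pair_ev q \<kappa>)"
      by (simp add: v bisum_cobracket_apply flip_apply sweedler_apply tens_apply functional_pair_ev 1
        sweedler_tensor u1(1) u2(1) alpha_in_tensor_space functional_ev functional_pt alpha_apply)
  qed (rule bisum_cobracket_in_tensor_space)
  with u show ?thesis by blast
qed

section \<open>The Lie bialgebra axioms for the bisum\<close>

lemma lie_algebra_bisum: "lie_algebra E bisum_bracket"
proof -
  interpret dual: vector_space sd by (rule vector_space_sd)
  have "bilin E E E bisum_bracket"
    by (auto simp: bilin_def linear_iff_hom vector_space_E bisum_bracket_def E_apply coad_simps br_simps
        dual.scale_right_diff_distrib)
  moreover have "bisum_bracket v v = 0" for v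
    by (auto simp: bisum_bracket_def br_self split_beta zero_prod_def)
  \<comment> \<open>The bracket is that of a semidirect product with an abelian ideal:
    \<open>coad_br\<close> settles the first component and \<open>jacobi\<close> the second.\<close>
  moreover have "bisum_bracket u (bisum_bracket v w) + bisum_bracket v (bisum_bracket w u)
      + bisum_bracket w (bisum_bracket u v) = 0" for u v w
    by (auto simp: bisum_bracket_def jacobi split_beta zero_prod_def coad_simps coad_br)
  ultimately show ?thesis by (simp add: lie_algebra_def)
qed

lemma lie_coalgebra_bisum:
  assumes pre_Lie and covariant
  shows "lie_coalgebra E bisum_cobracket"
  unfolding lie_coalgebra_iff
proof (intro conjI allI impI linear_bisum_cobracket bisum_cobracket_skew)
  note pre = assms(1)[unfolded pre_Lie_def, rule_format]
  note cov = assms(2)[unfolded covariant_def, rule_format]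
  fix v :: "'d \<times> 'g" and f g h
  assume f: "functional E f" and g: "functional E g" and h: "functional E h"
  obtain p \<pi> where fp: "f = pair_ev p \<pi>" by (rule functional_EE[OF f])
  obtain q \<kappa> where gq: "g = pair_ev q \<kappa>" by (rule functional_EE[OF g])
  obtain r \<rho> where hr: "h = pair_ev r \<rho>" by (rule functional_EE[OF h])
  obtain \<phi> X where v: "v = (\<phi>, X)" by (cases v)
  \<comment> \<open>\<open>T \<pi>\<close> is the transpose of \<open>\<Xi> \<pi>\<close>; its
    values exist by reflexivity. It expresses the inner cobracket as a single
    \<open>pair_ev\<close>.\<close>
  have "\<exists>y. \<forall>\<phi>. ev \<phi> y = ev (\<Xi> \<pi> \<phi>) x" for \<pi> x
    using functional_sdE[OF functional_ev_Xi(2)[of \<pi> x]] by metis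
  then obtain T where T: "\<And>\<pi> x \<phi>. ev \<phi> (T \<pi> x) = ev (\<Xi> \<pi> \<phi>) x" by metis
  have inner: "(\<lambda>b. bisum_cobracket b (pair_ev p \<pi>) (pair_ev q \<kappa>))
      = pair_ev (br p q - T \<pi> q + T \<kappa> p) (\<Xi> \<pi> \<kappa> - \<Xi> \<kappa> \<pi>)" for p \<pi> q \<kappa>
  proof
    show "bisum_cobracket b (pair_ev p \<pi>) (pair_ev q \<kappa>)
      = pair_ev (br p q - T \<pi> q + T \<kappa> p) (\<Xi> \<pi> \<kappa> - \<Xi> \<kappa> \<pi>) b" for b
      by (cases b) (simp add: bisum_cobracket_apply pair_ev_def ev_simps T)
  qed
  have T_br: "ev \<phi> (br p (T \<pi> q)) = - ev (\<Xi> \<pi> (ad p \<phi>)) q" for \<phi> p \<pi> q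
    by (simp add: T[symmetric] ev_coad)
  \<comment> \<open>One term of the cyclic sum, expanded with \<open>pre\<close> and
    \<open>cov\<close>. Under cyclic permutation its \<Xi>-terms cancel in pairs, and
    \<open>J\<close> disposes of the double brackets.\<close>
  define W where "W p \<pi> q \<kappa> r \<rho> = ev (\<Xi> \<pi> (\<Xi> \<kappa> \<rho> - \<Xi> \<rho> \<kappa>) - (\<Xi> \<kappa> (\<Xi> \<rho> \<pi>) - \<Xi> \<rho> (\<Xi> \<kappa> \<pi>))) X
      + (ev \<phi> (br p (br q r)) + ev (\<Xi> \<kappa> (ad p \<phi>)) r - ev (\<Xi> \<rho> (ad p \<phi>)) q)
      - (ev (\<Xi> \<pi> (ad r \<phi>)) q - ev (\<Xi> \<pi> (ad q \<phi>)) r - ev (\<Xi> \<kappa> (\<Xi> \<pi> \<phi>)) r + ev (\<Xi> \<rho> (\<Xi> \<pi> \<phi>)) q)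
      + ev (\<Xi> \<kappa> (\<Xi> \<rho> \<phi>) - \<Xi> \<rho> (\<Xi> \<kappa> \<phi>)) p" for p \<pi> q \<kappa> r \<rho>
  have W: "bisum_cobracket v (pair_ev p \<pi>) (\<lambda>b. bisum_cobracket b (pair_ev q \<kappa>) (pair_ev r \<rho>)) = W p \<pi> q \<kappa> r \<rho>"
    for p \<pi> q \<kappa> r \<rho>
    unfolding inner v bisum_cobracket_apply pre W_def
    by (simp add: br_simps ev_simps T T_br cov)
  have "ev \<phi> (br p (br q r)) + ev \<phi> (br q (br r p)) + ev \<phi> (br r (br p q)) = 0"
    using arg_cong[OF jacobi[of p q r], of "ev \<phi>"] by (simp add: ev_simps)
  then have J: "ev \<phi> (br p (br q r)) = - ev \<phi> (br q (br r p)) - ev \<phi> (br r (br p q))"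
    by (simp add: algebra_simps eq_neg_iff_add_eq_0)
  show "bisum_cobracket v f (\<lambda>b. bisum_cobracket b g h) + bisum_cobracket v h (\<lambda>b. bisum_cobracket b f g)
      + bisum_cobracket v g (\<lambda>b. bisum_cobracket b h f) = 0"
    unfolding fp gq hr W by (simp add: W_def J Xi_simps ev_simps algebra_simps)
qed

lemma lie_bialgebra_bisum:
  assumes pre_Lie and covariant and exchange
  shows "lie_bialgebra E bisum_bracket bisum_cobracket"
  unfolding lie_bialgebra_iff
proof (intro conjI allI impI lie_algebra_bisum lie_coalgebra_bisum assms(1,2))
  note cov = assms(2)[unfolded covariant_def, rule_format]
  note exch = assms(3)[unfolded exchange_def, rule_format]
  fix v w :: "'d \<times> 'g" and f g
  assume f: "functional E f" and g: "functional E g"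
  obtain p \<pi> where fp: "f = pair_ev p \<pi>" by (rule functional_EE[OF f])
  obtain q \<kappa> where gq: "g = pair_ev q \<kappa>" by (rule functional_EE[OF g])
  obtain \<phi> X where v: "v = (\<phi>, X)" by (cases v)
  obtain \<psi> Y where w: "w = (\<psi>, Y)" by (cases w)
  \<comment> \<open>The transpose of the adjoint action of the bisum maps each
    \<open>pair_ev\<close> to another one, so every term of the cocycle condition is a value of
    \<open>D\<close>.\<close>
  have comp: "(\<lambda>a. pair_ev p \<pi> (bisum_bracket (\<phi>, X) a)) = pair_ev (- br X p) (ad p \<phi> - ad X \<pi>)"
    for p \<pi> \<phi> X
  proof
    show "pair_ev p \<pi> (bisum_bracket (\<phi>, X) a) = pair_ev (- br X p) (ad p \<phi> - ad X \<pi>) a" for a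
      using br_swap[of "snd a" p]
      by (simp add: bisum_bracket_def split_beta pair_ev_def ev_simps ev_coad)
  qed
  define D where "D \<phi> X p \<pi> q \<kappa> = ev (\<Xi> \<pi> \<kappa>) X - ev (\<Xi> \<kappa> \<pi>) X + ev \<phi> (br p q) - ev (\<Xi> \<pi> \<phi>) q + ev (\<Xi> \<kappa> \<phi>) p"
    for \<phi> X p \<pi> q \<kappa>
  have D: "bisum_cobracket (\<phi>, X) (pair_ev p \<pi>) (pair_ev q \<kappa>) = D \<phi> X p \<pi> q \<kappa>" for \<phi> X p \<pi> q \<kappa>
    by (simp add: D_def bisum_cobracket_apply)
  have j: "ev \<phi> (br X (br p q)) = ev \<phi> (br (br X p) q) + ev \<phi> (br p (br X q))" for \<phi> X p q
    by (simp add: br_br ev_simps)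
  have "D (ad X \<psi> - ad Y \<phi>) (br X Y) p \<pi> q \<kappa> =
      D \<psi> Y (- br X p) (ad p \<phi> - ad X \<pi>) q \<kappa> + D \<psi> Y p \<pi> (- br X q) (ad q \<phi> - ad X \<kappa>)
      - (D \<phi> X (- br Y p) (ad p \<psi> - ad Y \<pi>) q \<kappa> + D \<phi> X p \<pi> (- br Y q) (ad q \<psi> - ad Y \<kappa>))"
    \<comment> \<open>The first four instances treat the terms mixing one of \<open>\<phi>\<close>,
      \<open>\<psi>\<close> with one of \<open>X\<close>, \<open>Y\<close>, together with
      \<open>cov\<close>. The next two treat the terms in both \<open>\<phi>\<close> and
      \<open>\<psi>\<close>, and \<open>cocycle\<close> the terms in \<open>X\<close> and
      \<open>Y\<close> alone. The fact \<open>j\<close> handles double brackets.\<close>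
    using exch[of p \<psi> \<kappa> X] exch[of q \<psi> \<pi> X] exch[of p \<phi> \<kappa> Y] exch[of q \<phi> \<pi> Y]
      exch[of p \<phi> \<psi> q] exch[of p \<psi> \<phi> q] cocycle[of \<pi> \<kappa> X Y]
    by (simp add: D_def dbr_eq ev_simps Xi_simps br_simps cov ev_coad
        j[of \<psi> X p q] j[of \<phi> Y p q] algebra_simps)
  then show "bisum_cobracket (bisum_bracket v w) f g =
      bisum_cobracket w (\<lambda>a. f (bisum_bracket v a)) g + bisum_cobracket w f (\<lambda>a. g (bisum_bracket v a))
      - (bisum_cobracket v (\<lambda>a. f (bisum_bracket w a)) g + bisum_cobracket v f (\<lambda>a. g (bisum_bracket w a)))"
    unfolding fp gq v w comp D by (simp add: bisum_bracket_def D)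
qed

end

theorem lemma6p1:
  fixes sg :: "'k::field \<Rightarrow> 'g::ab_group_add \<Rightarrow> 'g" and B :: "'g set"
    and br :: "'g \<Rightarrow> 'g \<Rightarrow> 'g" and \<delta> :: "'g \<Rightarrow> ('k, 'g, 'g) tensor"
    and sd :: "'k \<Rightarrow> 'd::ab_group_add \<Rightarrow> 'd" and ev :: "'d \<Rightarrow> 'g \<Rightarrow> 'k"
    and \<Xi> :: "'d \<Rightarrow> 'd \<Rightarrow> 'd" and \<alpha> :: "'d \<Rightarrow> ('k, 'g, 'd) tensor"
  defines "\<delta>d \<equiv> dual_cobracket sd ev br"
    and "E \<equiv> module_prod.scale sd sg"
  assumes "finite_dimensional_vector_space sg B"
    and "lie_bialgebra sg br \<delta>"
    and "dual_space sg sd ev"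
    and "bilin sd sd sd \<Xi>"
    and "\<And>\<phi> \<psi>. \<Xi> \<phi> \<psi> - \<Xi> \<psi> \<phi> = dual_bracket ev \<delta> \<phi> \<psi>"
    and "linear_to_tensor sd sg sd \<alpha>"
    and "\<And>\<phi> \<psi> x. \<alpha> \<phi> (ev \<psi>) (\<lambda>\<chi>. ev \<chi> x) = - ev (\<Xi> \<psi> \<phi>) x"
  shows "(braided_lie_bialgebra sg br \<delta> sd (\<lambda>_ _. 0) \<delta>d (coad ev br) \<alpha> \<longleftrightarrow>
            pre_lie_structure sd (dual_bracket ev \<delta>) \<Xi> \<and>
            (\<forall>\<phi> \<psi>. \<delta>d (\<Xi> \<phi> \<psi>) =
               sweedler sd sd (\<delta>d \<psi>) (\<lambda>\<psi>1 \<psi>2. tens sd sd (\<Xi> \<phi> \<psi>1) \<psi>2)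
               + sweedler sd sd (\<delta>d \<psi>) (\<lambda>\<psi>1 \<psi>2. tens sd sd \<psi>1 (\<Xi> \<phi> \<psi>2))) \<and>
            (\<forall>\<phi> \<psi>. sweedler sd sd (\<delta>d \<phi>) (\<lambda>\<phi>1 \<phi>2. tens sd sd (\<Xi> \<phi>1 \<psi>) \<phi>2) =
               sweedler sd sd (\<delta>d \<psi>) (\<lambda>\<psi>1 \<psi>2. tens sd sd \<psi>1 (\<Xi> \<psi>2 \<phi>))))
       \<and> (braided_lie_bialgebra sg br \<delta> sd (\<lambda>_ _. 0) \<delta>d (coad ev br) \<alpha> \<longrightarrow>
            lie_bialgebra E
              (\<lambda>(\<phi>, x) (\<psi>, y). (coad ev br x \<psi> - coad ev br y \<phi>, br x y))
              (\<lambda>(\<phi>, X).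
                 sweedler sg sg (\<delta> X) (\<lambda>x1 x2. tens E E (0, x1) (0, x2))
                 + sweedler sd sd (\<delta>d \<phi>) (\<lambda>\<phi>1 \<phi>2. tens E E (\<phi>1, 0) (\<phi>2, 0))
                 + (let t = sweedler sg sd (\<alpha> \<phi>) (\<lambda>a \<chi>. tens E E (0, a) (\<chi>, 0))
                    in t - flip t)))"
proof -
  interpret split_dual_bracket sg B sd ev br \<delta> \<Xi> \<alpha>
    by (intro split_dual_bracket.intro lie_bialgebra_dual.intro dual_pair.intro
        dual_pair_axioms.intro lie_bialgebra_dual_axioms.intro split_dual_bracket_axioms.intro assms)
  show ?thesis
    using braided_iff lie_bialgebra_bisum
    unfolding \<delta>d_def E_def pre_lie_structure_iff covariant_iff exchange_iff
      bisum_bracket_def bisum_cobracket_def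
    by blast
qed

end
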